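(* Let $N\ge1$ be an integer and let $\mathcal{X}_N$ be the algebraic variety defined in the context. Then every coordinate $X^{\pm}_\gamma(u)$ of every point of $\mathcal{X}_N(\overline{\mathbb{Q}})$ is a $2$-adic unit (that is, has valuation $0$ under every valuation of $\overline{\mathbb{Q}}$ extending the $2$-adic valuation of $\mathbb{Q}$), and $\mathcal{X}_N$ is zero-dimensional (it has only finitely many complex points).
   Context: Notation: $\mathbf{e}_M(x)=\exp(2\pi i x/M)$; elements of $\mathbb{Z}^2,\mathbb{Q}^2$ are row vectors; $\omega(v,w)=v_1w_2-v_2w_1$. Let $\Gamma_N$ be the set of $\gamma=\begin{pmatrix}a&b\\c&d\end{pmatrix}\in\mathrm{SL}_2(\mathbb{Z})$ with $c>0$ and trace $N+2$. For $\gamma\in\Gamma_N$: $\Lambda_\gamma=\{u\in\mathbb{Z}^2:u\gamma\equiv u\pmod N\}=\mathbb{Z}^2(\gamma-I)$, $G_\gamma=\mathbb{Z}^2/\Lambda_\gamma$ (order $N$), $$\langle u\rangle_\gamma=(-1)^{u_1+u_2+u_1u_2}\mathbf{e}_{2N}(\omega(u\gamma,u)),\qquad\langle u;v\rangle_\gamma=\mathbf{e}_N(\omega(u\gamma-u,v)),$$ which are well defined on $G_\gamma$, and $\mu_\gamma=\dfrac{\eta(\gamma z)}{\eta(z)\sqrt{cz+d}}$ ($z$ in the upper half-plane, $\eta$ the Dedekind eta function, principal square root; independent of $z$, a root of unity). $\mathcal{X}_N$ has coordinates $X^+_\gamma(u),X^-_\gamma(u)$ for $\gamma\in\Gamma_N$,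 $u\in G_\gamma$, where $X^+_\gamma(u)=X^-_\gamma(u)$ for $u\ne0$, and where coordinates belonging to conjugate matrices are identified: $X^\pm_{\delta\gamma\delta^{-1}}(u\delta^{-1})=X^\pm_\gamma(u)$ whenever $\delta\in\mathrm{SL}_2(\mathbb{Z})$ and $\gamma,\delta\gamma\delta^{-1}\in\Gamma_N$ (so, there being finitely many conjugacy classes of trace $N+2$, there are finitely many distinct coordinates). Its defining equations are the following. (1) For every $\gamma\in\Gamma_N$: $$X_\gamma^{\pm}(0)=\sqrt{\tfrac{N+2\pm\sqrt{N^2+4N}}{2}},\qquad X^+_\gamma(u)X^-_\gamma(-u)=\langle u\rangle_\gamma^{-1}\ (u\in G_\gamma),$$ $$\frac1{\sqrt N}\sum_{x\in G_\gamma}\langle x;u\rangle_\gamma X^+_\gamma(x)=\mu_\gamma\frac1{X^-_\gamma(u)}\ (u\in G_\gamma),$$ $$\frac1{\sqrt N}\sum_{x\in G_\gamma}\langle x;u\rangle_\gamma\frac{X^+_\gamma(x)}{X^-_\gamma(x+v)}=\frac{X^+_\gamma(u+v)}{X^-_\gamma(u)X^-_\gamma(v)}\ (u,v\in G_\gamma,\ (u,v)\ne(0,0)).$$ (2) (Distribution relations.) For every $\gamma\in\Gamma_N$, every $g=(m,k)\in\mathbb{Z}^2$, whose order in $G_\gamma$ is denoted $\mathrm{ord}(g)$, every $(\ell,j)\in\mathbb{Z}^2$ and each sign: $$\mu_\gamma^{-\mathrm{ord}(g)}\prod_{n=1}^{\mathrm{ord}(g)}X^{\pm}_\gamma(\ell+nm,j+nk)=\mu_{\gamma'}^{-1}X^{\pm}_{\gamma'}(h\ell,\,yj-f\ell),$$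 where, writing $(m,k)(I-\gamma)^{-1}=(r_1,r_2)\in\mathbb{Q}^2$: $h\ge1$ is the smallest integer with $hr_1\in\mathbb{Z}$; $hr_2\equiv x/y\pmod{\mathbb{Z}}$ with $y\ge1$, $\gcd(x,y)=1$; $w$ is an integer with $wr_1\equiv 1/h\pmod{\mathbb{Z}}$ and $f$ is an integer with $wyr_2\equiv f/h\pmod{\mathbb{Z}}$; and $$\gamma'=VU^{-1}\gamma UV^{-1},\qquad U=\begin{pmatrix}1&0\\0&y\end{pmatrix},\quad V=\begin{pmatrix}1&f\\0&h\end{pmatrix},$$ which again lies in $\Gamma_N$. *)

theory Defs
  imports "HOL-Analysis.Analysis" "HOL-Computational_Algebra.Computational_Algebra"
begin

definition e_root :: "nat \<Rightarrow> int \<Rightarrow> complex" where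
  "e_root M k = exp (2 * of_real pi * \<i> * of_int k / of_nat M)"

definition symp :: "int^2 \<Rightarrow> int^2 \<Rightarrow> int" where
  "symp v w = v$1 * w$2 - v$2 * w$1"

definition SL2Z :: "(int^2^2) set" where
  "SL2Z = {\<gamma>. det \<gamma> = 1}"

definition GammaN :: "nat \<Rightarrow> (int^2^2) set" where
  "GammaN N = {\<gamma> \<in> SL2Z. \<gamma>$2$1 > 0 \<and> trace \<gamma> = int N + 2}"

text \<open>Vectors in \<open>\<int>\<^sup>2\<close> are row vectors: matrices act on the right, by \<^const>\<open>vector_matrix_mult\<close>.\<close>

definition Lam :: "nat \<Rightarrow> int^2^2 \<Rightarrow> (int^2) set" where
  "Lam N \<gamma> = {u. \<forall>i. int N dvd (u v* \<gamma>)$i - u$i}"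

definition G_quot :: "nat \<Rightarrow> int^2^2 \<Rightarrow> (int^2) set set" where
  "G_quot N \<gamma> = UNIV // {(u, u'). u - u' \<in> Lam N \<gamma>}"

text \<open>Functions on the quotient are represented by functions on \<open>\<int>\<^sup>2\<close> that are periodic
  modulo \<^term>\<open>Lam N \<gamma>\<close>; for such \<open>F\<close> the choice of representatives below is immaterial.\<close>

definition sum_G :: "nat \<Rightarrow> int^2^2 \<Rightarrow> (int^2 \<Rightarrow> complex) \<Rightarrow> complex" where
  "sum_G N \<gamma> F = (\<Sum>C\<in>G_quot N \<gamma>. F (SOME x. x \<in> C))"

definition ord_G :: "nat \<Rightarrow> int^2^2 \<Rightarrow> int^2 \<Rightarrow> nat" where
  "ord_G N \<gamma> g = (LEAST n. n \<ge> 1 \<and> of_nat n *s g \<in> Lam N \<gamma>)"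

definition bracket1 :: "nat \<Rightarrow> int^2^2 \<Rightarrow> int^2 \<Rightarrow> complex" where
  "bracket1 N \<gamma> u =
     (-1) powi (u$1 + u$2 + u$1 * u$2) * e_root (2 * N) (symp (u v* \<gamma>) u)"

definition bracket2 :: "nat \<Rightarrow> int^2^2 \<Rightarrow> int^2 \<Rightarrow> int^2 \<Rightarrow> complex" where
  "bracket2 N \<gamma> u v = e_root N (symp (u v* \<gamma> - u) v)"

definition dedekind_eta :: "complex \<Rightarrow> complex" where
  "dedekind_eta z =
     exp (2 * of_real pi * \<i> * z / 24) *
     (\<Prod>n. 1 - exp (2 * of_real pi * \<i> * of_nat (Suc n) * z))"

definition eta_ratio :: "int^2^2 \<Rightarrow> complex \<Rightarrow> complex" where
  "eta_ratio \<gamma> z =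
     (let cz_d = of_int (\<gamma>$2$1) * z + of_int (\<gamma>$2$2) in
        dedekind_eta ((of_int (\<gamma>$1$1) * z + of_int (\<gamma>$1$2)) / cz_d)
        / (dedekind_eta z * csqrt cz_d))"

text \<open>For \<open>\<gamma> \<in> SL2Z\<close> with \<open>\<gamma>$2$1 > 0\<close> the ratio does not depend on the point \<open>z\<close> of the upper
  half-plane, so it is evaluated at \<open>\<i>\<close>.\<close>

definition mu :: "int^2^2 \<Rightarrow> complex" where
  "mu \<gamma> = eta_ratio \<gamma> \<i>"

datatype sgn_pm = Plus | Minus

fun pm :: "sgn_pm \<Rightarrow> real" where
  "pm Plus = 1"
| "pm Minus = -1"

type_synonym coords = "sgn_pm \<Rightarrow> int^2^2 \<Rightarrow> int^2 \<Rightarrow> complex"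

text \<open>A point is a family of values \<open>X s \<gamma> u\<close>; only \<open>\<gamma> \<in> GammaN N\<close> and the class of \<open>u\<close> are
  meaningful. Setting the values at all other \<open>\<gamma>\<close> to \<open>0\<close> makes families correspond
  one-to-one to points, so that counting families counts points.\<close>

definition coordinate_family :: "nat \<Rightarrow> complex set \<Rightarrow> coords \<Rightarrow> bool" where
  "coordinate_family N K X \<longleftrightarrow>
     (\<forall>s. \<forall>\<gamma>. \<gamma> \<notin> GammaN N \<longrightarrow> (\<forall>u. X s \<gamma> u = 0)) \<and>
     (\<forall>s. \<forall>\<gamma>\<in>GammaN N. \<forall>u. X s \<gamma> u \<in> K) \<and>
     (\<forall>s. \<forall>\<gamma>\<in>GammaN N. \<forall>u. \<forall>u'. u - u' \<in> Lam N \<gamma> \<longrightarrow> X s \<gamma> u = X s \<gamma> u') \<and>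
     (\<forall>\<gamma>\<in>GammaN N. \<forall>u. u \<notin> Lam N \<gamma> \<longrightarrow> X Plus \<gamma> u = X Minus \<gamma> u) \<and>
     (\<forall>s. \<forall>\<gamma>\<in>GammaN N. \<forall>\<delta>\<in>SL2Z. \<delta> ** \<gamma> ** matrix_inv \<delta> \<in> GammaN N \<longrightarrow>
        (\<forall>u. X s (\<delta> ** \<gamma> ** matrix_inv \<delta>) (u v* matrix_inv \<delta>) = X s \<gamma> u))"

definition local_equations :: "nat \<Rightarrow> coords \<Rightarrow> int^2^2 \<Rightarrow> bool" where
  "local_equations N X \<gamma> \<longleftrightarrow>
     (\<forall>s. X s \<gamma> 0 =
        of_real (sqrt ((real N + 2 + pm s * sqrt (real N ^ 2 + 4 * real N)) / 2))) \<and>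
     (\<forall>u. X Plus \<gamma> u * X Minus \<gamma> (- u) = inverse (bracket1 N \<gamma> u)) \<and>
     (\<forall>u. 1 / of_real (sqrt (real N)) * sum_G N \<gamma> (\<lambda>x. bracket2 N \<gamma> x u * X Plus \<gamma> x)
          = mu \<gamma> * (1 / X Minus \<gamma> u)) \<and>
     (\<forall>u v. \<not> (u \<in> Lam N \<gamma> \<and> v \<in> Lam N \<gamma>) \<longrightarrow>
        1 / of_real (sqrt (real N)) *
          sum_G N \<gamma> (\<lambda>x. bracket2 N \<gamma> x u * (X Plus \<gamma> x / X Minus \<gamma> (x + v)))
        = X Plus \<gamma> (u + v) / (X Minus \<gamma> u * X Minus \<gamma> v))"

abbreviation rat_mat :: "int^2^2 \<Rightarrow> rat^2^2" where
  "rat_mat A \<equiv> map_matrix of_int A"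

definition vec2 :: "'a \<Rightarrow> 'a \<Rightarrow> 'a^2" where
  "vec2 a b = (\<chi> i. if i = 1 then a else b)"

definition mat2 :: "'a \<Rightarrow> 'a \<Rightarrow> 'a \<Rightarrow> 'a \<Rightarrow> 'a^2^2" where
  "mat2 a b c d = vec2 (vec2 a b) (vec2 c d)"

text \<open>The integers \<open>x\<close>, \<open>w\<close>, \<open>f\<close> are only determined up to congruences; all admissible
  choices give the same relation modulo the conjugation identifications.\<close>

definition dist_params ::
  "int^2^2 \<Rightarrow> int^2 \<Rightarrow> nat \<Rightarrow> nat \<Rightarrow> int \<Rightarrow> int \<Rightarrow> int \<Rightarrow> bool" where
  "dist_params \<gamma> g h y x w f \<longleftrightarrow>
     (let r = (\<chi> i. rat_of_int (g$i)) v* matrix_inv (mat 1 - rat_mat \<gamma>) in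
        h = (LEAST n. n \<ge> 1 \<and> of_nat n * r$1 \<in> \<int>) \<and>
        y \<ge> 1 \<and> coprime x (int y) \<and> of_nat h * r$2 - of_int x / of_nat y \<in> \<int> \<and>
        of_int w * r$1 - 1 / of_nat h \<in> \<int> \<and>
        of_int w * of_nat y * r$2 - of_int f / of_nat h \<in> \<int>)"

definition dist_matrix :: "int^2^2 \<Rightarrow> nat \<Rightarrow> nat \<Rightarrow> int \<Rightarrow> rat^2^2" where
  "dist_matrix \<gamma> h y f =
     (let U = mat2 1 0 0 (of_nat y); V = mat2 1 (of_int f) 0 (of_nat h)
      in V ** matrix_inv U ** rat_mat \<gamma> ** U ** matrix_inv V)"

definition distribution_relations :: "nat \<Rightarrow> coords \<Rightarrow> int^2^2 \<Rightarrow> bool" where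
  "distribution_relations N X \<gamma> \<longleftrightarrow>
     (\<forall>s g p h y x w f. \<forall>\<gamma>'\<in>GammaN N.
        dist_params \<gamma> g h y x w f \<and> rat_mat \<gamma>' = dist_matrix \<gamma> h y f \<longrightarrow>
        mu \<gamma> powi (- int (ord_G N \<gamma> g)) *
          (\<Prod>n = 1..ord_G N \<gamma> g. X s \<gamma> (p + of_nat n *s g))
        = inverse (mu \<gamma>') * X s \<gamma>' (vec2 (int h * p$1) (int y * p$2 - f * p$1)))"

text \<open>The \<open>K\<close>-valued points, for a subfield \<open>K\<close> of the complex numbers.\<close>

definition XN_points :: "nat \<Rightarrow> complex set \<Rightarrow> coords set" where
  "XN_points N K =
     {X. coordinate_family N K X \<and>
         (\<forall>\<gamma>\<in>GammaN N. local_equations N X \<gamma> \<and> distribution_relations N X \<gamma>)}"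

definition Qbar :: "complex set" where
  "Qbar = {z. algebraic z}"

text \<open>Only the values of \<open>v\<close> at nonzero algebraic numbers matter. Real values suffice: as
  \<open>Qbar\<close> is algebraic over the rationals, the value group of any extension of the 2-adic
  valuation is torsion over \<open>\<int>\<close> and embeds uniquely in the reals over \<open>\<int>\<close>.\<close>

definition extends_2adic :: "(complex \<Rightarrow> real) \<Rightarrow> bool" where
  "extends_2adic v \<longleftrightarrow>
     (\<forall>x\<in>Qbar - {0}. \<forall>y\<in>Qbar - {0}. v (x * y) = v x + v y) \<and>
     (\<forall>x\<in>Qbar - {0}. \<forall>y\<in>Qbar - {0}. x + y \<noteq> 0 \<longrightarrow> v (x + y) \<ge> min (v x) (v y)) \<and>
     (\<forall>a b :: int. a \<noteq> 0 \<longrightarrow> b \<noteq> 0 \<longrightarrow>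
        v (of_int a / of_int b) = real (multiplicity 2 a) - real (multiplicity 2 b))"

definition two_adic_unit :: "complex \<Rightarrow> bool" where
  "two_adic_unit x \<longleftrightarrow> x \<in> Qbar \<and> x \<noteq> 0 \<and> (\<forall>v. extends_2adic v \<longrightarrow> v x = 0)"

end

theory Submission
  imports Defs "HOL-Library.Function_Algebras"
begin

text \<open>
  The argument is valuation-theoretic. Suppose some coordinate \<open>\<xi>\<close> is not integral over the
  localisation of the integers at 2. Then \<open>2\<close> and \<open>1/\<xi>\<close> generate a proper ideal of \<open>\<int>[1/\<xi>]\<close>, inside the
  ring of functions on the set of points, and this ideal extends to a proper ideal \<open>I\<close> of a ring \<open>A\<close>
  which behaves like a valuation ring for the finitely many coordinate ratios. Choose a
  coordinate \<open>t = X\<^sup>+\<^sub>\<gamma>(u)\<close> of largest size, so that \<open>1/t \<in> I\<close>, and divide the last equation of (1) with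
  \<open>v = -2u\<close> by \<open>t\<^sup>2\<close>. The right-hand side falls into \<open>I\<close>. On the left the reflection \<open>x \<mapsto> 2u - x\<close> pairs
  up the summands, which contributes multiples of 2. Among its fixed points \<open>x = u + s\<close> with \<open>2s = 0\<close>,
  those with \<open>s \<noteq> 0\<close> have \<open>X\<^sup>+\<^sub>\<gamma>(x)/t \<in> I\<close>: by the distribution relation for \<open>s\<close> the product
  \<open>X\<^sup>+\<^sub>\<gamma>(x) t\<close> is a unit times a single coordinate. So the remaining summand at \<open>x = u\<close>, a root of unity,
  lies in \<open>I\<close>, a contradiction. Hence each coordinate satisfies one fixed integral equation at all
  points simultaneously, which gives finiteness, and both factors of
  \<open>X\<^sup>+\<^sub>\<gamma>(u) X\<^sup>-\<^sub>\<gamma>(-u) = \<langle>u\<rangle>\<^sub>\<gamma>\<^sup>-\<^sup>1\<close> have nonnegative valuation, which gives the unit property.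
\<close>

(* Otherwise "$" is ambiguous between vector components and power series coefficients. *)
no_notation fps_nth (infixl \<open>$\<close> 75)

section \<open>Subrings with an ideal and extension of valuations\<close>

text \<open>The ambient ring may have zero divisors, since it will be a ring of functions.
  Properness of \<open>I\<close> is carried separately as \<open>1 \<notin> I\<close>, so that pairs
  with \<open>I = A\<close> are instances too.\<close>

locale subring_ideal =
  fixes A I :: "'r::comm_ring_1 set"
  assumes one_mem: "1 \<in> A"
    and add_mem: "\<lbrakk>x \<in> A; y \<in> A\<rbrakk> \<Longrightarrow> x + y \<in> A"
    and uminus_mem: "x \<in> A \<Longrightarrow> - x \<in> A"
    and mult_mem: "\<lbrakk>x \<in> A; y \<in> A\<rbrakk> \<Longrightarrow> x * y \<in> A"
    and ideal_subset: "I \<subseteq> A"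
    and zero_mem_ideal: "0 \<in> I"
    and add_mem_ideal: "\<lbrakk>x \<in> I; y \<in> I\<rbrakk> \<Longrightarrow> x + y \<in> I"
    and mult_mem_ideal: "\<lbrakk>x \<in> A; y \<in> I\<rbrakk> \<Longrightarrow> x * y \<in> I"
begin

lemma zero_mem: "0 \<in> A"
  using ideal_subset zero_mem_ideal by blast

lemma power_mem: "x \<in> A \<Longrightarrow> x ^ n \<in> A"
  by (induction n) (auto intro: one_mem mult_mem)

lemma of_nat_mem: "of_nat n \<in> A"
  by (induction n) (auto intro: zero_mem one_mem add_mem)

lemma sum_mem: "(\<And>i. i \<in> S \<Longrightarrow> f i \<in> A) \<Longrightarrow> sum f S \<in> A"
  by (induction S rule: infinite_finite_induct) (auto intro: zero_mem add_mem)

lemma sum_mem_ideal: "(\<And>i. i \<in> S \<Longrightarrow> f i \<in> I) \<Longrightarrow> sum f S \<in> I"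
  by (induction S rule: infinite_finite_induct) (auto intro: zero_mem_ideal add_mem_ideal)

lemma uminus_mem_ideal: "x \<in> I \<Longrightarrow> - x \<in> I"
  using mult_mem_ideal[of "- 1" x] uminus_mem[OF one_mem] by simp

lemma diff_mem: "x \<in> A \<Longrightarrow> y \<in> A \<Longrightarrow> x - y \<in> A"
  using add_mem[of x "- y"] uminus_mem[of y] by simp

text \<open>The non-fixed points of the involution pair up, contributing twice an element of the ring.\<close>

lemma sum_involution_mem_ideal:
  assumes "finite S" and two: "2 \<in> I"
    and "\<And>x. x \<in> S \<Longrightarrow> \<tau> x \<in> S \<and> \<tau> (\<tau> x) = x \<and> f (\<tau> x) = f x \<and> f x \<in> A"
    and "\<And>x. x \<in> S \<Longrightarrow> \<tau> x = x \<Longrightarrow> f x \<in> I"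
  shows "sum f S \<in> I"
  using assms(1,3,4)
proof (induction "card S" arbitrary: S rule: less_induct)
  case less
  show ?case
  proof (cases "\<forall>x\<in>S. \<tau> x = x")
    case True
    then show ?thesis using less.prems by (intro sum_mem_ideal) auto
  next
    case False
    then obtain x where x: "x \<in> S" "\<tau> x \<noteq> x" by blast
    let ?T = "S - {x, \<tau> x}"
    have "card ?T < card S"
      using x less.prems(1) by (intro psubset_card_mono) auto
    moreover have "\<tau> y \<in> ?T \<and> \<tau> (\<tau> y) = y \<and> f (\<tau> y) = f y \<and> f y \<in> A" if "y \<in> ?T" for y
      using that less.prems(2)[of y] less.prems(2)[of x] x
      by (metis DiffE DiffI insertE insertI1 insertI2 singletonD)
    ultimately have "sum f ?T \<in> I"
      using less.prems by (intro less.hyps) auto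
    moreover have "sum f S = f x * 2 + sum f ?T"
    proof -
      have "sum f S = sum f {x, \<tau> x} + sum f ?T"
        using x less.prems by (metis add.commute empty_subsetI insert_subset sum.subset_diff)
      then show ?thesis using x less.prems(2)[of x] by (simp add: mult_2_right)
    qed
    ultimately show ?thesis
      using less.prems(2)[OF x(1)] two by (simp add: add_mem_ideal mult_mem_ideal)
  qed
qed

end

text \<open>For a subring \<open>A\<close> this is the ring \<open>A[y]\<close>, and for an ideal
  \<open>I\<close> of \<open>A\<close> the extended ideal \<open>I A[y]\<close>; constraining only
  the coefficients covers both.\<close>

definition poly_values :: "'r::comm_ring_1 set \<Rightarrow> 'r \<Rightarrow> 'r set" where
  "poly_values A y = {poly p y | p. \<forall>i. coeff p i \<in> A}"

lemma poly_valuesI: "(\<And>i. coeff p i \<in> A) \<Longrightarrow> poly p y \<in> poly_values A y"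
  by (auto simp: poly_values_def)

lemma poly_valuesE:
  assumes "x \<in> poly_values A y"
  obtains p where "x = poly p y" "\<And>i. coeff p i \<in> A"
  using assms by (auto simp: poly_values_def)

context subring_ideal
begin

lemma subset_poly_values: "A \<subseteq> poly_values A y" "I \<subseteq> poly_values I y"
proof -
  have "x \<in> poly_values B y" if "x \<in> B" "0 \<in> B" for x B
    using poly_valuesI[of "[:x:]" B y] that by (auto simp: coeff_pCons split: nat.splits)
  then show "A \<subseteq> poly_values A y" "I \<subseteq> poly_values I y"
    using zero_mem zero_mem_ideal by auto
qed

lemma mem_poly_values: "y \<in> poly_values A y"
  using poly_valuesI[of "[:0, 1:]" A y] zero_mem one_mem
  by (auto simp: coeff_pCons split: nat.splits)

lemma subring_ideal_poly_values: "subring_ideal (poly_values A y) (poly_values I y)"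
proof
  show "1 \<in> poly_values A y" using subset_poly_values one_mem by blast
  show "0 \<in> poly_values I y" using subset_poly_values zero_mem_ideal by blast
  show "poly_values I y \<subseteq> poly_values A y"
    using ideal_subset by (auto simp: poly_values_def)
next
  fix a b assume ab: "a \<in> poly_values A y" "b \<in> poly_values A y"
  then obtain p q where pq: "a = poly p y" "\<And>i. coeff p i \<in> A" "b = poly q y" "\<And>i. coeff q i \<in> A"
    by (elim poly_valuesE) blast
  show "a + b \<in> poly_values A y"
    using poly_valuesI[of "p + q" A y] pq by (simp add: add_mem)
  show "a * b \<in> poly_values A y"
    using poly_valuesI[of "p * q" A y] pq by (simp add: coeff_mult sum_mem mult_mem)
  show "- a \<in> poly_values A y"
    using poly_valuesI[of "- p" A y] pq by (simp add: uminus_mem)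
next
  fix a b assume ab: "a \<in> poly_values I y" "b \<in> poly_values I y"
  then obtain p q where pq: "a = poly p y" "\<And>i. coeff p i \<in> I" "b = poly q y" "\<And>i. coeff q i \<in> I"
    by (elim poly_valuesE) blast
  show "a + b \<in> poly_values I y"
    using poly_valuesI[of "p + q" I y] pq by (simp add: add_mem_ideal)
next
  fix a b assume ab: "a \<in> poly_values A y" "b \<in> poly_values I y"
  then obtain p q where pq: "a = poly p y" "\<And>i. coeff p i \<in> A" "b = poly q y" "\<And>i. coeff q i \<in> I"
    by (elim poly_valuesE) blast
  show "a * b \<in> poly_values I y"
    using poly_valuesI[of "p * q" I y] pq by (simp add: coeff_mult sum_mem_ideal mult_mem_ideal)
qed

text \<open>With \<open>b\<close> the constant term of \<open>q\<close>, the relation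
  \<open>poly q z = 1\<close> multiplied by \<open>y ^ n\<close> becomes
  \<open>(1 - b) * y ^ n = poly r y\<close> with \<open>degree r < n\<close>. This allows the top
  term of \<open>p\<close> to be removed.\<close>

lemma degree_descent:
  assumes yz: "y * z = 1" and "1 \<notin> I"
    and p: "\<And>i. coeff p i \<in> I" "poly p y = 1"
    and q: "\<And>i. coeff q i \<in> I" "poly q z = 1"
    and le: "degree q \<le> degree p"
  shows "\<exists>p'. (\<forall>i. coeff p' i \<in> I) \<and> poly p' y = 1 \<and> degree p' < degree p"
proof -
  define n where "n = degree p"
  define k where "k = degree q"
  define b where "b = coeff q 0"
  have "n > 0"
  proof (rule ccontr)
    assume "\<not> n > 0"
    then obtain a where "p = [:a:]" unfolding n_def by (metis degree_eq_zeroE gr0I)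
    then show False using p(1)[of 0] p(2) assms(2) by simp
  qed
  define r where "r = (\<Sum>j=1..k. monom (coeff q j) (n - j))"
  define l where "l = (\<Sum>i<n. monom (coeff p i) i)"
  \<comment> \<open>Comes from \<open>1 = b + (1 - b) * poly p y\<close>, where the top term
    \<open>(1 - b) * coeff p n * y ^ n\<close> is replaced by \<open>coeff p n * poly r y\<close>.
    Nothing is divided by \<open>1 - b\<close>, so \<open>A\<close> need not be local.\<close>
  define p' where "p' = [:b:] + smult (1 - b) l + smult (coeff p n) r"
  have "poly q z = (\<Sum>j\<le>k. coeff q j * z ^ j)" by (simp add: poly_altdef k_def)
  also have "\<dots> = b + (\<Sum>j=1..k. coeff q j * z ^ j)"
    by (simp add: sum.atMost_shift sum.atLeast1_atMost_eq b_def lessThan_Suc_atMost)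
  finally have *: "(\<Sum>j=1..k. coeff q j * z ^ j) = 1 - b" using q(2) by (simp add: algebra_simps)
  have "poly r y = (\<Sum>j=1..k. coeff q j * y ^ (n - j))"
    by (simp add: r_def poly_sum poly_monom)
  also have "\<dots> = (\<Sum>j=1..k. (coeff q j * z ^ j) * y ^ n)"
  proof (rule sum.cong)
    fix j assume "j \<in> {1..k}"
    then have "y ^ n = y ^ j * y ^ (n - j)"
      using le by (simp add: n_def k_def flip: power_add)
    then have "z ^ j * y ^ n = (y * z) ^ j * y ^ (n - j)"
      by (simp add: power_mult_distrib algebra_simps)
    then show "coeff q j * y ^ (n - j) = coeff q j * z ^ j * y ^ n"
      using yz by (simp add: mult.assoc)
  qed simp
  also have "\<dots> = (1 - b) * y ^ n" unfolding sum_distrib_right[symmetric] * ..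
  finally have r: "poly r y = (1 - b) * y ^ n" .
  have "poly p y = poly l y + coeff p n * y ^ n"
    unfolding poly_altdef[of p y]
    by (simp add: n_def l_def poly_sum poly_monom flip: lessThan_Suc_atMost)
  then have l: "poly l y = 1 - coeff p n * y ^ n" using p(2) by (simp add: algebra_simps)
  have "poly p' y = 1" by (simp add: p'_def r l algebra_simps)
  moreover have "degree p' < n"
  proof -
    have "degree r < n" unfolding r_def
      using \<open>n > 0\<close> by (intro degree_sum_less) (auto intro!: le_less_trans[OF degree_monom_le])
    moreover have "degree l < n" unfolding l_def
      using \<open>n > 0\<close> by (intro degree_sum_less) (auto intro!: le_less_trans[OF degree_monom_le])
    ultimately show ?thesis unfolding p'_def
      using \<open>n > 0\<close> by (intro degree_add_less) (auto intro!: le_less_trans[OF degree_smult_le])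
  qed
  moreover have "coeff p' i \<in> I" for i
  proof -
    have "1 - b \<in> A" using q(1) ideal_subset one_mem by (auto simp: b_def intro: diff_mem)
    moreover have "coeff l i \<in> I" "coeff r i \<in> I"
      unfolding l_def r_def coeff_sum
      by (rule sum_mem_ideal; use p(1) q(1) zero_mem_ideal in auto)+
    moreover have "coeff [:b:] i \<in> I"
      using q(1) zero_mem_ideal by (auto simp: b_def coeff_pCons split: nat.splits)
    ultimately show ?thesis
      using p(1) ideal_subset by (auto simp: p'_def intro!: add_mem_ideal mult_mem_ideal)
  qed
  ultimately show ?thesis unfolding n_def by blast
qed

text \<open>Representations of 1 in both extended ideals would start an infinite descent:
  \<open>degree_descent\<close> lowers the larger of the two degrees, with \<open>y\<close> and
  \<open>z\<close> exchanged if necessary.\<close>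

lemma one_notin_poly_values:
  assumes "y * z = 1" and I: "1 \<notin> I"
  shows "1 \<notin> poly_values I y \<or> 1 \<notin> poly_values I z"
proof -
  have False if "y * z = 1" "\<And>i. coeff p i \<in> I" "poly p y = 1" "\<And>i. coeff q i \<in> I" "poly q z = 1"
    for p q y z
    using that
  proof (induction "degree p + degree q" arbitrary: p q y z rule: less_induct)
    case less
    show False
    proof (cases "degree q \<le> degree p")
      case True
      then obtain p' where "\<forall>i. coeff p' i \<in> I" "poly p' y = 1" "degree p' < degree p"
        using degree_descent[OF less.prems(1) I less.prems(2-5)] by blast
      then show False using less.hyps[of p' q y z] less.prems by auto
    next
      case False
      then obtain q' where "\<forall>i. coeff q' i \<in> I" "poly q' z = 1" "degree q' < degree q"
        using degree_descent[of z y q p] less.prems I by (auto simp: mult.commute)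
      then show False using less.hyps[of p q' y z] less.prems by auto
    qed
  qed
  then show ?thesis using assms(1) unfolding poly_values_def by (smt (verit) mem_Collect_eq)
qed

end

text \<open>A finite form of Chevalley's extension theorem: the pair is a valuation ring as far as the
  units in the given finite set are concerned.\<close>

lemma chevalley_extension_finite:
  fixes A I :: "'r::comm_ring_1 set"
  assumes "finite Y" "subring_ideal A I" "1 \<notin> I" and "\<And>y. y \<in> Y \<Longrightarrow> y * u y = 1"
  shows "\<exists>A' I'. A \<subseteq> A' \<and> I \<subseteq> I' \<and> subring_ideal A' I' \<and> 1 \<notin> I' \<and> (\<forall>y\<in>Y. y \<in> A' \<or> u y \<in> A')"
  using assms(1,4)
proof induction
  case empty
  then show ?case using assms(2,3) by blast
next
  case (insert y Y)
  then obtain B J where BJ: "A \<subseteq> B" "I \<subseteq> J" "subring_ideal B J" "1 \<notin> J"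
    "\<forall>y\<in>Y. y \<in> B \<or> u y \<in> B" by auto
  interpret subring_ideal B J by fact
  obtain w where w: "w = y \<or> w = u y" "1 \<notin> poly_values J w"
    using one_notin_poly_values[of y "u y"] insert.prems BJ by auto
  show ?case
    using BJ w subset_poly_values[of w] mem_poly_values[of w] subring_ideal_poly_values[of w]
    by (intro exI[of _ "poly_values B w"] exI[of _ "poly_values J w"]) auto
qed

text \<open>In the ring generated by \<open>w\<close>, the ideal generated by 2 and \<open>w\<close>
  consists of the values of integer polynomials with even constant term; the hypothesis says that
  this ideal is proper.\<close>

lemma subring_ideal_even_constant_term:
  fixes w :: "'r::comm_ring_1"
  assumes "\<And>n a. even (a 0 :: int) \<Longrightarrow> (\<Sum>i\<le>n. of_int (a i) * w ^ i) \<noteq> 1"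
  shows "\<exists>A I. subring_ideal A I \<and> 1 \<notin> I \<and> 2 \<in> I \<and> w \<in> I"
proof -
  define A where "A = poly_values \<int> w"
  define I where "I = {poly p w | p. (\<forall>i. coeff p i \<in> \<int>) \<and> (\<exists>k::int. coeff p 0 = of_int (2 * k))}"
  have I_intro: "poly p w \<in> I" if "\<And>i. coeff p i \<in> \<int>" "coeff p 0 = of_int (2 * k)" for p k
    unfolding I_def using that by blast
  interpret Z: subring_ideal "\<int> :: 'r set" "\<int> :: 'r set"
    by standard (auto intro: Ints_minus)
  interpret P: subring_ideal A A
    unfolding A_def by (rule Z.subring_ideal_poly_values)
  have "subring_ideal A I"
  proof
    show "I \<subseteq> A" by (auto simp: I_def A_def intro: poly_valuesI)
    show "0 \<in> I" using I_intro[of 0 0] by simp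
  next
    fix x y assume "x \<in> I" "y \<in> I"
    then obtain p q k l where "x = poly p w" "\<forall>i. coeff p i \<in> \<int>" "coeff p 0 = of_int (2 * k)"
      "y = poly q w" "\<forall>i. coeff q i \<in> \<int>" "coeff q 0 = of_int (2 * l)"
      unfolding I_def by blast
    then show "x + y \<in> I" using I_intro[of "p + q" "k + l"] by (auto simp: algebra_simps)
  next
    fix x y assume "x \<in> A" "y \<in> I"
    then obtain p q l where pq: "x = poly p w" "\<And>i. coeff p i \<in> \<int>"
      "y = poly q w" "\<forall>i. coeff q i \<in> \<int>" "coeff q 0 = of_int (2 * l)"
      unfolding I_def A_def by (auto elim!: poly_valuesE)
    obtain m where "coeff p 0 = of_int m" using pq(2)[of 0] by (auto elim: Ints_cases)
    then have "coeff (p * q) 0 = of_int (2 * (m * l))"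
      using pq by (simp add: coeff_mult algebra_simps)
    moreover have "coeff (p * q) i \<in> \<int>" for i
      using pq by (auto simp: coeff_mult intro!: Z.sum_mem)
    ultimately show "x * y \<in> I" using I_intro[of "p * q" "m * l"] pq by simp
  qed (auto intro: P.one_mem P.add_mem P.uminus_mem P.mult_mem)
  moreover have "1 \<notin> I"
  proof
    assume "1 \<in> I"
    then obtain p k where p: "1 = poly p w" "\<And>i. coeff p i \<in> \<int>" "coeff p 0 = of_int (2 * k)"
      unfolding I_def by blast
    then have "\<forall>i. \<exists>c. coeff p i = of_int c" by (meson Ints_cases)
    then obtain a' where a': "\<And>i. coeff p i = of_int (a' i)" by metis
    \<comment> \<open>The ring may have positive characteristic, so the integer chosen for the
      constant term need not be even; it is replaced by the known even one.\<close>
    define a where "a = a'(0 := 2 * k)"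
    have "coeff p i = of_int (a i)" for i
      using a' p(3) by (auto simp: a_def)
    then have "(\<Sum>i\<le>degree p. of_int (a i) * w ^ i) = 1"
      using p(1) by (simp add: poly_altdef)
    then show False using assms[of a "degree p"] by (auto simp: a_def)
  qed
  moreover have "2 \<in> I" using I_intro[of "[:2:]" 1] by (auto simp: coeff_pCons split: nat.splits)
  moreover have "w \<in> I"
    using I_intro[of "[:0, 1:]" 0] by (auto simp: coeff_pCons split: nat.splits)
  ultimately show ?thesis by blast
qed

section \<open>Matrices of trace N + 2\<close>

lemma dedekind_eta_nonzero:
  assumes "Im z > 0"
  shows "dedekind_eta z \<noteq> 0"
proof -
  define q where "q = exp (2 * of_real pi * \<i> * z)"
  have q: "norm q < 1" using assms by (simp add: q_def)
  have pow: "exp (2 * of_real pi * \<i> * of_nat (Suc n) * z) = q ^ Suc n" for n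
    unfolding q_def by (subst exp_of_nat_mult[symmetric]) (simp add: algebra_simps)
  have "summable (\<lambda>n. norm (q ^ Suc n))"
    using summable_geometric[of "norm q"] q by (subst summable_Suc_iff) (simp add: norm_power)
  then have "abs_convergent_prod (\<lambda>n. 1 - q ^ Suc n)"
    by (intro summable_imp_abs_convergent_prod) simp
  then have "convergent_prod (\<lambda>n. 1 - q ^ Suc n)"
    by (rule abs_convergent_prod_imp_convergent_prod)
  moreover have "1 - q ^ Suc n \<noteq> 0" for n
  proof
    assume "1 - q ^ Suc n = 0"
    then have "q ^ Suc n = 1" by (simp del: power_Suc)
    then show False using power_eq_1_iff[of q "Suc n"] q by simp
  qed
  ultimately have "(\<Prod>n. 1 - q ^ Suc n) \<noteq> 0"
    by (intro prodinf_nonzero) auto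
  then show ?thesis unfolding dedekind_eta_def pow by simp
qed

lemma GammaN_iff:
  "\<gamma> \<in> GammaN N \<longleftrightarrow> \<gamma>$1$1 * \<gamma>$2$2 - \<gamma>$1$2 * \<gamma>$2$1 = 1 \<and> \<gamma>$2$1 > 0 \<and> \<gamma>$1$1 + \<gamma>$2$2 = int N + 2"
  by (auto simp: GammaN_def SL2Z_def det_2 trace_def sum_2)

text \<open>The eta quotient is taken at \<open>\<i>\<close>, and the image of \<open>\<i>\<close>
  under \<open>\<gamma>\<close> is again in the upper half-plane, where eta has no zeros.\<close>

lemma mu_nonzero:
  assumes "\<gamma> \<in> GammaN N"
  shows "mu \<gamma> \<noteq> 0"
proof -
  define a b c d where "a = \<gamma>$1$1" and "b = \<gamma>$1$2" and "c = \<gamma>$2$1" and "d = \<gamma>$2$2"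
  have det: "a * d - b * c = 1" and c: "c > 0"
    using assms by (auto simp: GammaN_iff a_def b_def c_def d_def)
  define w :: complex where "w = of_int c * \<i> + of_int d"
  have w: "w \<noteq> 0" using c by (auto simp: w_def complex_eq_iff)
  have "Im ((of_int a * \<i> + of_int b) / w) = (a * d - b * c) / (norm w)\<^sup>2"
    by (simp add: w_def Im_divide cmod_power2 algebra_simps)
  also have "\<dots> > 0" using w det by simp
  finally show ?thesis
    using w dedekind_eta_nonzero
    by (simp add: mu_def eta_ratio_def Let_def w_def a_def b_def c_def d_def)
qed

lemma vec_eq_2: "x = y \<longleftrightarrow> x$1 = y$1 \<and> x$2 = y$2" for x y :: "'a^2"
  by (simp add: vec_eq_iff forall_2)

lemma vector_matrix_mult_2: "(u v* A)$j = u$1 * A$1$j + u$2 * A$2$j" for u :: "'a::comm_semiring_1^2"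
  by (simp add: vector_matrix_mult_def sum_2 mult.commute)

lemma matrix_mult_2: "(A ** B)$i$j = A$i$1 * B$1$j + A$i$2 * B$2$j" for A :: "'a::semiring_1^2^2"
  by (simp add: matrix_matrix_mult_def sum_2)

lemma mat2_nth [simp]:
  "mat2 a b c d $ 1 $ 1 = a" "mat2 a b c d $ 1 $ 2 = b"
  "mat2 a b c d $ 2 $ 1 = c" "mat2 a b c d $ 2 $ 2 = d"
  by (simp_all add: mat2_def vec2_def)

lemma vec2_nth [simp]: "vec2 a b $ 1 = a" "vec2 a b $ 2 = b"
  by (simp_all add: vec2_def)

lemma mat_1_nth [simp]:
  "(mat 1 :: 'a::{zero,one}^2^2) $ 1 $ 1 = 1" "(mat 1 :: 'a::{zero,one}^2^2) $ 1 $ 2 = 0"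
  "(mat 1 :: 'a::{zero,one}^2^2) $ 2 $ 1 = 0" "(mat 1 :: 'a::{zero,one}^2^2) $ 2 $ 2 = 1"
  by (simp_all add: mat_def)

lemma matrix_inv_eq:
  fixes A B :: "'a::semiring_1^'n^'n"
  assumes "A ** B = mat 1" "B ** A = mat 1"
  shows "matrix_inv A = B"
proof -
  have *: "A ** matrix_inv A = mat 1 \<and> matrix_inv A ** A = mat 1"
    unfolding matrix_inv_def by (rule someI[of _ B]) (use assms in blast)
  have "matrix_inv A = (B ** A) ** matrix_inv A" using assms by simp
  also have "\<dots> = B" using * by (simp add: matrix_mul_assoc[symmetric])
  finally show ?thesis .
qed

section \<open>The lattice \<open>Lam\<close> and its finite quotient\<close>

lemma Lam_iff: "u \<in> Lam N \<gamma> \<longleftrightarrow>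
  int N dvd u$1 * (\<gamma>$1$1 - 1) + u$2 * \<gamma>$2$1 \<and> int N dvd u$1 * \<gamma>$1$2 + u$2 * (\<gamma>$2$2 - 1)"
  by (simp add: Lam_def forall_2 vector_matrix_mult_2 algebra_simps)

lemma Lam_zero: "0 \<in> Lam N \<gamma>"
  by (simp add: Lam_iff)

lemma Lam_add:
  assumes "u \<in> Lam N \<gamma>" "v \<in> Lam N \<gamma>"
  shows "u + v \<in> Lam N \<gamma>"
proof -
  have "((u + v) v* \<gamma>)$i - (u + v)$i = ((u v* \<gamma>)$i - u$i) + ((v v* \<gamma>)$i - v$i)" for i
    by (simp add: vector_matrix_mult_2 algebra_simps)
  then show ?thesis using assms unfolding Lam_def by (simp only: mem_Collect_eq dvd_add simp_thms)
qed

lemma Lam_uminus: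
  assumes "u \<in> Lam N \<gamma>"
  shows "- u \<in> Lam N \<gamma>"
proof -
  have "((- u) v* \<gamma>)$i - (- u)$i = - ((u v* \<gamma>)$i - u$i)" for i
    by (simp add: vector_matrix_mult_2 algebra_simps)
  then show ?thesis using assms unfolding Lam_def by (simp only: mem_Collect_eq dvd_minus_iff simp_thms)
qed

lemma Lam_multiple: "(\<And>i. int N dvd u$i) \<Longrightarrow> u \<in> Lam N \<gamma>"
  by (simp add: Lam_iff)

lemma equiv_Lam: "equiv UNIV {(u, u'). u - u' \<in> Lam N \<gamma>}"
proof (rule equivI)
  show "refl {(u, u'). u - u' \<in> Lam N \<gamma>}" by (auto simp: refl_on_def Lam_zero)
  show "sym {(u, u'). u - u' \<in> Lam N \<gamma>}"
    by (rule symI) (use Lam_uminus in fastforce)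
  show "trans {(u, u'). u - u' \<in> Lam N \<gamma>}"
    by (rule transI) (use Lam_add in fastforce)
qed auto

lemma finite_int_box: "finite {u :: int^2. \<forall>i. u$i \<in> {m..n}}"
proof -
  have "{u :: int^2. \<forall>i. u$i \<in> {m..n}} \<subseteq> (\<lambda>(a, b). vec2 a b) ` ({m..n} \<times> {m..n})"
  proof
    fix u :: "int^2" assume "u \<in> {u. \<forall>i. u$i \<in> {m..n}}"
    moreover have "u = vec2 (u$1) (u$2)" by (simp add: vec_eq_2)
    ultimately show "u \<in> (\<lambda>(a, b). vec2 a b) ` ({m..n} \<times> {m..n})"
      by (auto intro!: image_eqI[where x = "(u$1, u$2)"])
  qed
  then show ?thesis by (rule finite_subset) auto
qed

text \<open>Holds because the lattice contains all multiples of \<open>N\<close>. The box is larger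
  than a set of representatives, which is harmless as it only serves to prove finiteness.\<close>

lemma Lam_representative:
  assumes "N \<ge> 1"
  obtains u' :: "int^2" where "\<And>i. u'$i \<in> {0..int N}" "u - u' \<in> Lam N \<gamma>"
proof
  define u' :: "int^2" where "u' = (\<chi> i. u$i mod int N)"
  show "u'$i \<in> {0..int N}" for i
    using assms pos_mod_bound[of "int N" "u$i"] by (simp add: u'_def less_imp_le)
  show "u - u' \<in> Lam N \<gamma>"
    by (rule Lam_multiple) (simp add: u'_def minus_mod_eq_mult_div)
qed

lemma finite_G_quot:
  assumes "N \<ge> 1"
  shows "finite (G_quot N \<gamma>)"
proof -
  let ?R = "{(u, u'). u - u' \<in> Lam N \<gamma>}"
  have "G_quot N \<gamma> \<subseteq> (\<lambda>u. ?R `` {u}) ` {u. \<forall>i. u$i \<in> {0..int N}}"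
  proof
    fix C assume "C \<in> G_quot N \<gamma>"
    then obtain u where u: "C = ?R `` {u}" unfolding G_quot_def by (auto elim!: quotientE)
    obtain u' :: "int^2" where u': "\<And>i. u'$i \<in> {0..int N}" "u - u' \<in> Lam N \<gamma>"
      using Lam_representative[OF assms] by blast
    have "C = ?R `` {u'}" unfolding u
      by (rule equiv_class_eq[OF equiv_Lam]) (use u' in auto)
    then show "C \<in> (\<lambda>u. ?R `` {u}) ` {u. \<forall>i. u$i \<in> {0..int N}}" using u' by blast
  qed
  then show ?thesis by (rule finite_subset) (intro finite_imageI finite_int_box)
qed

lemma inverse_SL2Z:
  assumes "\<delta> \<in> SL2Z"
  shows "matrix_inv \<delta> = mat2 (\<delta>$2$2) (- \<delta>$1$2) (- \<delta>$2$1) (\<delta>$1$1)"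
  using assms
  by (intro matrix_inv_eq) (auto simp: vec_eq_2 matrix_mult_2 SL2Z_def det_2 algebra_simps)

text \<open>In a conjugacy class, a matrix with minimal \<open>c\<close> and with \<open>\<bar>a - d\<bar> \<le> c\<close> has bounded entries:
  since \<open>(a - d)\<^sup>2 + 4 b c = N\<^sup>2 + 4 N > 0\<close> this is the reduction of an indefinite quadratic form.\<close>

lemma GammaN_reduction:
  assumes "\<gamma> \<in> GammaN N" "N \<ge> 1"
  shows "\<exists>\<delta>\<in>SL2Z. \<delta> ** \<gamma> ** matrix_inv \<delta> \<in> GammaN N \<and>
    (\<forall>i j. \<bar>(\<delta> ** \<gamma> ** matrix_inv \<delta>)$i$j\<bar> \<le> (int N + 2)\<^sup>2)"
proof -
  define conj where "conj \<delta> = \<delta> ** \<gamma> ** matrix_inv \<delta>" for \<delta> :: "int^2^2"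
  have mul: "conj (\<epsilon> ** \<delta>) = \<epsilon> ** conj \<delta> ** matrix_inv \<epsilon>" "\<epsilon> ** \<delta> \<in> SL2Z"
    if "\<epsilon> \<in> SL2Z" "\<delta> \<in> SL2Z" for \<epsilon> \<delta>
  proof -
    show *: "\<epsilon> ** \<delta> \<in> SL2Z" using that by (simp add: SL2Z_def det_mul)
    have "matrix_inv (\<epsilon> ** \<delta>) = matrix_inv \<delta> ** matrix_inv \<epsilon>"
      unfolding inverse_SL2Z[OF that(1)] inverse_SL2Z[OF that(2)] inverse_SL2Z[OF *]
      by (simp add: vec_eq_2 matrix_mult_2 algebra_simps)
    then show "conj (\<epsilon> ** \<delta>) = \<epsilon> ** conj \<delta> ** matrix_inv \<epsilon>"
      by (simp add: conj_def matrix_mul_assoc)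
  qed
  \<comment> \<open>\<open>P n\<close> says that \<open>n\<close> occurs as lower left entry of a
    conjugate in \<open>GammaN N\<close>; a conjugate with the least such entry is chosen.\<close>
  define P where "P n \<longleftrightarrow> (\<exists>\<delta>\<in>SL2Z. conj \<delta> \<in> GammaN N \<and> nat (conj \<delta> $2$1) = n)" for n
  have id: "mat 1 \<in> SL2Z" "conj (mat 1) = \<gamma>"
    by (simp_all add: SL2Z_def conj_def matrix_inv_eq[of "mat 1" "mat 1"])
  have "P (nat (\<gamma>$2$1))" unfolding P_def using id assms by metis
  then have least: "P (LEAST n. P n)" by (rule LeastI)
  then obtain \<delta> where \<delta>: "\<delta> \<in> SL2Z" "conj \<delta> \<in> GammaN N" "nat (conj \<delta> $2$1) = (LEAST n. P n)"
    unfolding P_def by blast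
  \<comment> \<open>Conjugation by \<open>T\<close> adds \<open>2 * k * c\<close> to
    \<open>a - d\<close>. This \<open>k\<close> is \<open>(d - a) / (2 * c)\<close> rounded to a
    nearest integer, which makes \<open>\<bar>a - d\<bar> \<le> c\<close>.\<close>
  define k where "k = (conj \<delta>$2$2 - conj \<delta>$1$1 + conj \<delta>$2$1) div (2 * conj \<delta>$2$1)"
  define T where "T = mat2 1 k 0 1"
  have T: "T \<in> SL2Z" by (simp add: T_def SL2Z_def det_2)
  define \<beta> where "\<beta> = conj (T ** \<delta>)"
  have \<beta>eq: "\<beta> = T ** conj \<delta> ** matrix_inv T" unfolding \<beta>_def using mul(1)[OF T \<delta>(1)] .
  have entries: "\<beta>$1$1 = conj \<delta>$1$1 + k * conj \<delta>$2$1" "\<beta>$2$1 = conj \<delta>$2$1"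
    "\<beta>$2$2 = conj \<delta>$2$2 - k * conj \<delta>$2$1"
    "\<beta>$1$2 = conj \<delta>$1$2 + k * conj \<delta>$2$2 - k * (conj \<delta>$1$1 + k * conj \<delta>$2$1)"
    unfolding \<beta>eq inverse_SL2Z[OF T] by (simp_all add: T_def matrix_mult_2 algebra_simps)
  have \<beta>: "\<beta> \<in> GammaN N"
    using \<delta>(2) unfolding GammaN_iff entries by (auto simp: algebra_simps)
  define a b c d where "a = \<beta>$1$1" and "b = \<beta>$1$2" and "c = \<beta>$2$1" and "d = \<beta>$2$2"
  have G: "a * d - b * c = 1" "c > 0" "a + d = int N + 2"
    using \<beta> by (auto simp: GammaN_iff a_def b_def c_def d_def)
  have disc: "(a - d)\<^sup>2 + 4 * (b * c) = (int N)\<^sup>2 + 4 * int N"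
  proof -
    have "(a - d)\<^sup>2 + 4 * (b * c) = (a + d)\<^sup>2 - 4 * (a * d - b * c)"
      by (simp add: power2_eq_square algebra_simps)
    then show ?thesis unfolding G by (simp add: power2_eq_square algebra_simps)
  qed
  have ad: "\<bar>a - d\<bar> \<le> c"
  proof -
    define t where "t = conj \<delta>$2$2 - conj \<delta>$1$1 + c"
    have c': "conj \<delta>$2$1 = c" using entries by (simp add: c_def)
    have "t = 2 * c * k + t mod (2 * c)" by (simp add: k_def t_def c' mult_div_mod_eq)
    moreover have "0 \<le> t mod (2 * c)" "t mod (2 * c) < 2 * c" using G(2) by simp_all
    moreover have "a - d = 2 * (c * k) - t + c" 
      unfolding t_def a_def d_def entries c' by (simp add: algebra_simps)
    ultimately show ?thesis by linarith
  qed
  have minimal: "c \<le> c'" if "\<epsilon> \<in> SL2Z" "conj \<epsilon> \<in> GammaN N" "conj \<epsilon>$2$1 = c'" for \<epsilon> c'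
  proof -
    have "P (nat c')" unfolding P_def using that by auto
    then have "nat c \<le> nat c'" using \<delta>(3) entries by (simp add: c_def Least_le)
    moreover have "c' > 0" using that by (auto simp: GammaN_iff)
    ultimately show ?thesis by linarith
  qed
  \<comment> \<open>If \<open>b = 0\<close>, then \<open>a * d = 1\<close> contradicts the trace. If
    \<open>b < 0\<close>, conjugation by \<open>S\<close> turns \<open>- b\<close> into the lower
    left entry, so \<open>c \<le> - b\<close> by minimality, and the discriminant would be at most
    \<open>- 3 * c * c\<close>.\<close>
  have "b > 0"
  proof (rule ccontr)
    assume "\<not> b > 0"
    moreover have "b \<noteq> 0"
    proof
      assume "b = 0"
      then have "a * d = 1" using G by simp
      then show False using G(3) assms(2) by (auto simp: zmult_eq_1_iff)
    qed
    ultimately have "b < 0" by linarith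
    define S :: "int^2^2" where "S = mat2 0 (- 1) 1 0"
    have S: "S \<in> SL2Z" by (simp add: S_def SL2Z_def det_2)
    have "conj (S ** (T ** \<delta>)) = S ** \<beta> ** matrix_inv S"
      unfolding \<beta>_def using mul S T \<delta>(1) by simp
    also have "\<dots> = mat2 d (- c) (- b) a"
      unfolding inverse_SL2Z[OF S] a_def b_def c_def d_def
      by (simp add: S_def vec_eq_2 matrix_mult_2)
    finally have S': "conj (S ** (T ** \<delta>)) = mat2 d (- c) (- b) a" .
    moreover have "mat2 d (- c) (- b) a \<in> GammaN N"
      using G \<open>b < 0\<close> by (simp add: GammaN_iff algebra_simps)
    ultimately have "c \<le> - b"
      using minimal[of "S ** (T ** \<delta>)" "- b"] mul(2) S T \<delta>(1) by simp
    then have "c * c \<le> - b * c" using G(2) by (intro mult_right_mono) auto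
    moreover have "\<bar>a - d\<bar> * \<bar>a - d\<bar> \<le> c * c" using ad by (intro mult_mono) auto
    moreover have "\<bar>a - d\<bar> * \<bar>a - d\<bar> = (a - d)\<^sup>2" by (simp add: power2_eq_square flip: abs_mult)
    moreover have "c * c > 0" using G(2) by simp
    moreover have "(int N)\<^sup>2 \<ge> 0" by simp
    moreover have "- b * c = - (b * c)" by simp
    ultimately show False using disc by linarith
  qed
  \<comment> \<open>With \<open>b\<close> and \<open>c\<close> positive, the discriminant bounds
    \<open>4 * (b * c)\<close>, hence \<open>b\<close> and \<open>c\<close>; then
    \<open>\<bar>a - d\<bar> \<le> c\<close> and the trace bound \<open>a\<close> and
    \<open>d\<close>.\<close>
  define M where "M = (int N + 2)\<^sup>2"
  have "M = (int N)\<^sup>2 + 4 * int N + 4" by (simp add: M_def power2_eq_square algebra_simps)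
  then have D: "4 * (b * c) \<le> M" using disc zero_le_power2[of "a - d"] by linarith
  have "b * c \<ge> b" "b * c \<ge> c" using \<open>b > 0\<close> G(2) by simp_all
  then have bc: "b \<le> M" "4 * c \<le> M" using D \<open>b > 0\<close> by linarith+
  have "int N + 2 \<le> M" unfolding M_def by (rule self_le_power) auto
  moreover have "c \<le> M" using G(2) bc(2) by linarith
  moreover have "2 * a \<le> c + (int N + 2)" "2 * d \<le> c + (int N + 2)" "- a \<le> c" "- d \<le> c"
    using ad G(3) by linarith+
  ultimately have "a \<le> M" "- a \<le> M" "d \<le> M" "- d \<le> M" by linarith+
  then have "\<bar>a\<bar> \<le> M" "\<bar>d\<bar> \<le> M" by (simp_all add: abs_le_iff)
  then have "\<forall>i j. \<bar>\<beta>$i$j\<bar> \<le> M"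
    using bc \<open>b > 0\<close> G(2) by (simp add: forall_2 a_def b_def c_def d_def)
  then show ?thesis
    using \<beta> mul(2)[OF T \<delta>(1)] by (auto simp: \<beta>_def conj_def M_def)
qed

section \<open>The isogeny attached to a point of order two\<close>

lemma half_in_Ints_iff: "(rat_of_int m / 2 \<in> \<int>) \<longleftrightarrow> even m"
proof
  assume "rat_of_int m / 2 \<in> \<int>"
  then obtain k where "rat_of_int m / 2 = of_int k" by (auto elim: Ints_cases)
  then have "rat_of_int m = of_int (2 * k)" by simp
  then show "even m" by (simp only: of_int_eq_iff) simp
qed (auto elim!: evenE)

lemma dist_matrix_eq:
  assumes "h > 0" "y > 0"
  shows "dist_matrix \<gamma> h y f =
    (let a = of_int (\<gamma>$1$1); b = of_int (\<gamma>$1$2); c = of_int (\<gamma>$2$1); d = of_int (\<gamma>$2$2);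
         a' = a + of_int f * c / of_nat y; b' = b * of_nat y + of_int f * d
     in mat2 a' ((b' - of_int f * a') / of_nat h)
          (of_nat h * c / of_nat y) (d - of_int f * c / of_nat y))"
proof -
  have U: "matrix_inv (mat2 1 0 0 (of_nat y)) = mat2 1 0 0 (1 / rat_of_nat y)"
    using assms by (intro matrix_inv_eq) (auto simp: vec_eq_2 matrix_mult_2)
  have V: "matrix_inv (mat2 1 (of_int f) 0 (of_nat h)) =
      mat2 1 (- of_int f / of_nat h) 0 (1 / rat_of_nat h)"
    using assms by (intro matrix_inv_eq) (auto simp: vec_eq_2 matrix_mult_2)
  show ?thesis
    using assms unfolding dist_matrix_def Let_def U V
    by (simp add: vec_eq_2 matrix_mult_2 field_simps)
qed

text \<open>The determinant of the matrix to be inverted is \<open>2 - (a + d)\<close>, so the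
  right-hand side is its adjugate divided by the determinant.\<close>

lemma matrix_inv_one_minus_mat2:
  fixes a b c d k :: "'a::field"
  assumes "a * d - b * c = 1" "k * (a + d - 2) = 1"
  shows "matrix_inv (mat 1 - mat2 a b c d) = mat2 (k * (d - 1)) (k * - b) (k * - c) (k * (a - 1))"
proof (rule matrix_inv_eq)
  have *: "(1 - a) * (k * (d - 1)) + - b * (k * - c) = 1"
    using assms by algebra
  show "(mat 1 - mat2 a b c d) ** mat2 (k * (d - 1)) (k * - b) (k * - c) (k * (a - 1)) = mat 1"
    "mat2 (k * (d - 1)) (k * - b) (k * - c) (k * (a - 1)) ** (mat 1 - mat2 a b c d) = mat 1"
    using * by (simp_all add: vec_eq_2 matrix_mult_2) (simp_all add: algebra_simps)
qed

text \<open>The vector \<open>r\<close> of the distribution relation is half-integral but not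
  integral. According to whether its first entry is integral, the parameters are
  \<open>h = 1\<close>, \<open>y = 2\<close> or \<open>h = 2\<close>, \<open>y = 1\<close>; parity
  then makes the transformed matrix integral.\<close>

lemma order_two_isogeny:
  assumes \<gamma>: "\<gamma> \<in> GammaN N" and N: "N \<ge> 1" and s: "s \<notin> Lam N \<gamma>" "s + s \<in> Lam N \<gamma>"
  obtains \<gamma>' h y x w f where "\<gamma>' \<in> GammaN N" "dist_params \<gamma> s h y x w f"
    "rat_mat \<gamma>' = dist_matrix \<gamma> h y f"
proof -
  define a b c d where abcd: "a = \<gamma>$1$1" "b = \<gamma>$1$2" "c = \<gamma>$2$1" "d = \<gamma>$2$2"
  define s1 s2 where s12: "s1 = s$1" "s2 = s$2"
  have det: "a * d - b * c = 1" and c: "c > 0" and tr: "a = int N + 2 - d"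
    using \<gamma> by (auto simp: GammaN_iff abcd)
  have tr': "a + d = int N + 2" using tr by simp
  have "int N dvd (s1 + s1) * (a - 1) + (s2 + s2) * c"
    and "int N dvd (s1 + s1) * b + (s2 + s2) * (d - 1)"
    using s(2) by (auto simp: Lam_iff abcd s12)
  then obtain l1 l2 where l: "(s1 + s1) * (a - 1) + (s2 + s2) * c = int N * l1"
    "(s1 + s1) * b + (s2 + s2) * (d - 1) = int N * l2"
    by (auto elim!: dvdE)
  \<comment> \<open>As \<open>\<gamma> + \<gamma>\<^sup>-\<^sup>1 = N + 2\<close>, the inverse of
    \<open>1 - \<gamma>\<close> is \<open>1 - (\<gamma> - 1) / N\<close>. So \<open>(m1, m2)\<close>
    is \<open>2 s\<close> times that inverse, which is \<open>2 r\<close>.\<close>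
  define m1 m2 where "m1 = 2 * s1 - l1" and "m2 = 2 * s2 - l2"
  have m: "2 * (s1 * (1 - d) + s2 * c) = - (int N * m1)" "2 * (s1 * b + s2 * (1 - a)) = - (int N * m2)"
    using l unfolding m1_def m2_def tr by (simp_all add: algebra_simps)
  have sm: "2 * s1 = m1 * (1 - a) - m2 * c" "2 * s2 = m2 * (1 - d) - m1 * b"
  proof -
    have "int N * (2 * s1) = int N * (m1 * (1 - a) - m2 * c)"
    proof -
      have "int N * (m1 * (1 - a) - m2 * c) =
          2 * (s1 * b + s2 * (1 - a)) * c - 2 * (s1 * (1 - d) + s2 * c) * (1 - a)"
        unfolding m by (simp add: algebra_simps)
      also have "\<dots> = 2 * s1 * (a + d - 1 - (a * d - b * c))" by (simp add: algebra_simps)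
      also have "\<dots> = int N * (2 * s1)" unfolding det by (simp add: tr algebra_simps)
      finally show ?thesis ..
    qed
    then show "2 * s1 = m1 * (1 - a) - m2 * c" using N by simp
    have "int N * (2 * s2) = int N * (m2 * (1 - d) - m1 * b)"
    proof -
      have "int N * (m2 * (1 - d) - m1 * b) =
          2 * (s1 * (1 - d) + s2 * c) * b - 2 * (s1 * b + s2 * (1 - a)) * (1 - d)"
        unfolding m by (simp add: algebra_simps)
      also have "\<dots> = 2 * s2 * (a + d - 1 - (a * d - b * c))" by (simp add: algebra_simps)
      also have "\<dots> = int N * (2 * s2)" unfolding det by (simp add: tr algebra_simps)
      finally show ?thesis ..
    qed
    then show "2 * s2 = m2 * (1 - d) - m1 * b" using N by simp
  qed
  \<comment> \<open>Otherwise \<open>r\<close> would be integral and \<open>s\<close>, its image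
    under \<open>1 - \<gamma>\<close>, would lie in the lattice.\<close>
  have odd: "odd m1 \<or> odd m2"
  proof (rule ccontr)
    assume "\<not> ?thesis"
    then obtain k1 k2 where "m1 = 2 * k1" "m2 = 2 * k2" by (auto elim!: evenE)
    then have "s1 * (1 - d) + s2 * c = - (int N * k1)" "s1 * b + s2 * (1 - a) = - (int N * k2)"
      using m by simp_all
    then have "s1 * (a - 1) + s2 * c = int N * (s1 - k1)" "s1 * b + s2 * (d - 1) = int N * (s2 - k2)"
      by (simp_all add: tr algebra_simps)
    then have "s \<in> Lam N \<gamma>" by (simp add: Lam_iff flip: abcd s12)
    then show False using s by simp
  qed
  define r where "r = (\<chi> i. rat_of_int (s$i)) v* matrix_inv (mat 1 - rat_mat \<gamma>)"
  define k where "k = 1 / rat_of_nat N"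
  have "matrix_inv (mat 1 - rat_mat \<gamma>) =
      mat2 (k * of_int (d - 1)) (k * of_int (- b)) (k * of_int (- c)) (k * of_int (a - 1))"
  proof -
    have "rat_of_int (a * d - b * c) = 1" "k * rat_of_int (int N) = 1" "int N = a + d - 2"
      using det tr N by (simp_all add: k_def)
    then have "of_int a * of_int d - of_int b * of_int c = (1 :: rat)"
      "k * (of_int a + of_int d - 2) = 1" by simp_all
    moreover have "rat_mat \<gamma> = mat2 (of_int a) (of_int b) (of_int c) (of_int d)"
      by (simp add: vec_eq_2 abcd)
    ultimately show ?thesis using matrix_inv_one_minus_mat2 by simp
  qed
  then have r: "r$1 = of_int m1 / 2" "r$2 = of_int m2 / 2"
  proof -
    assume inv: "matrix_inv (mat 1 - rat_mat \<gamma>) =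
      mat2 (k * of_int (d - 1)) (k * of_int (- b)) (k * of_int (- c)) (k * of_int (a - 1))"
    have "r$1 = k * rat_of_int (- (2 * (s1 * (1 - d) + s2 * c))) / 2"
      "r$2 = k * rat_of_int (- (2 * (s1 * b + s2 * (1 - a)))) / 2"
      unfolding r_def inv by (simp_all add: vector_matrix_mult_2 algebra_simps add_divide_distrib diff_divide_distrib flip: s12)
    then show "r$1 = of_int m1 / 2" "r$2 = of_int m2 / 2"
      using N unfolding m by (simp_all add: k_def)
  qed
  show ?thesis
  proof (cases "even m1")
    case True
    then have m2: "odd m2" using odd by simp
    have "even (m1 * (1 - a) - m2 * c)" using sm(1) by (metis dvd_triv_left)
    then have "even (m2 * c)" using True by simp
    then have "even c" using m2 by simp
    then obtain e where e: "c = 2 * e" by (elim evenE)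
    \<comment> \<open>Here \<open>h = 1\<close> and \<open>y = 2\<close>: the isogeny halves
      \<open>c\<close>, which the first equation of \<open>sm\<close> forces to be even.\<close>
    define \<gamma>' where "\<gamma>' = mat2 a (2 * b) e d"
    have "\<gamma>' \<in> GammaN N"
      using det c tr' by (simp add: \<gamma>'_def GammaN_iff e mult.assoc)
    moreover have "rat_mat \<gamma>' = dist_matrix \<gamma> 1 2 0"
      using e by (simp add: dist_matrix_eq \<gamma>'_def vec_eq_2 Let_def flip: abcd)
    moreover have "(LEAST n. n \<ge> 1 \<and> rat_of_nat n * r$1 \<in> \<int>) = 1"
      using True by (intro Least_equality) (auto simp: r half_in_Ints_iff)
    then have "dist_params \<gamma> s 1 2 m2 0 0"
      using m2 True by (simp add: dist_params_def Let_def r coprime_right_2_iff_odd flip: r_def)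
    ultimately show ?thesis by (intro that)
  next
    case False
    have "even (m1 * (1 - a) - m2 * c)" "even (m2 * (1 - d) - m1 * b)"
      using sm by (metis dvd_triv_left)+
    then have "even (b + m2 * d - m2 * (a + m2 * c))" using False by auto
    then obtain e where e: "b + m2 * d - m2 * (a + m2 * c) = 2 * e" by (elim evenE)
    \<comment> \<open>Here \<open>h = 2\<close> and \<open>y = 1\<close>; with \<open>w = 1\<close>
      the congruence for \<open>f\<close> is solved by \<open>m2\<close>. The upper right entry is
      integral because both equations of \<open>sm\<close> have even left-hand sides.\<close>
    define \<gamma>' where "\<gamma>' = mat2 (a + m2 * c) e (2 * c) (d - m2 * c)"
    have "e * (2 * c) = (b + m2 * d - m2 * (a + m2 * c)) * c" unfolding e by simp
    then have "\<gamma>' \<in> GammaN N"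
      using det c tr' by (simp add: \<gamma>'_def GammaN_iff algebra_simps)
    moreover have "rat_mat \<gamma>' = dist_matrix \<gamma> 2 1 m2"
    proof -
      have "rat_of_int (b + m2 * d - m2 * (a + m2 * c)) = rat_of_int (2 * e)" unfolding e ..
      then show ?thesis
        by (simp add: dist_matrix_eq \<gamma>'_def vec_eq_2 Let_def flip: abcd)
    qed
    moreover have "(LEAST n. n \<ge> 1 \<and> rat_of_nat n * r$1 \<in> \<int>) = 2"
    proof (rule Least_equality)
      fix n :: nat assume n: "n \<ge> 1 \<and> rat_of_nat n * r$1 \<in> \<int>"
      then have "n \<noteq> 1" using False by (auto simp: r half_in_Ints_iff)
      then show "2 \<le> n" using n by simp
    qed (simp add: r)
    then have "dist_params \<gamma> s 2 1 m2 1 m2"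
      using False half_in_Ints_iff[of "m1 - 1"]
      by (simp add: dist_params_def Let_def r diff_divide_distrib flip: r_def)
    ultimately show ?thesis by (intro that)
  qed
qed

lemma ord_G_eq_2:
  assumes "s \<notin> Lam N \<gamma>" "s + s \<in> Lam N \<gamma>"
  shows "ord_G N \<gamma> s = 2"
  unfolding ord_G_def
proof (rule Least_equality)
  have "of_nat 2 *s s = s + s" by (simp add: vec_eq_2)
  then show "1 \<le> (2::nat) \<and> of_nat 2 *s s \<in> Lam N \<gamma>" using assms by simp
next
  fix n :: nat assume n: "1 \<le> n \<and> of_nat n *s s \<in> Lam N \<gamma>"
  then have "n \<noteq> 1" using assms by auto
  then show "2 \<le> n" using n by simp
qed

section \<open>Brackets and coordinates\<close>

lemma e_root_add: "e_root M (k + l) = e_root M k * e_root M l"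
  by (simp add: e_root_def exp_add[symmetric] ring_distribs add_divide_distrib)

lemma e_root_nonzero [simp]: "e_root M k \<noteq> 0"
  by (simp add: e_root_def)

lemma e_root_eq_1:
  assumes "M \<ge> 1" "int M dvd k"
  shows "e_root M k = 1"
proof -
  obtain j where "k = int M * j" using assms(2) by (elim dvdE)
  then have "e_root M k = exp (of_int (2 * j) * of_real pi * \<i>)"
    using assms(1) by (simp add: e_root_def field_simps)
  then show ?thesis using exp_integer_2pi[of "of_int j"] by (simp add: mult_ac)
qed

lemma e_root_cong:
  assumes "M \<ge> 1" "int M dvd k - l"
  shows "e_root M k = e_root M l"
  using e_root_eq_1[OF assms] e_root_add[of M "k - l" l] by simp

lemma e_root_power:
  assumes "M \<ge> 1"
  shows "e_root M k ^ M = 1"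
proof -
  have "e_root M k ^ n = e_root M (int n * k)" for n
    by (induction n) (simp_all add: e_root_add[symmetric] e_root_eq_1[OF assms] algebra_simps)
  then show ?thesis using assms by (simp add: e_root_eq_1)
qed

lemma e_root_double: "e_root M k = e_root (2 * M) (2 * k)"
  by (simp add: e_root_def mult_ac)

lemma bracket2_altdef:
  "bracket2 N \<gamma> u v = e_root (2 * N) (2 * symp (u v* \<gamma> - u) v)"
  unfolding bracket2_def by (rule e_root_double)

text \<open>The sign is absorbed as \<open>e_root (2 * N) (int N * k)\<close>, so that identities
  between brackets become congruences modulo \<open>2 * N\<close>.\<close>

lemma bracket1_altdef:
  assumes "N \<ge> 1"
  shows "bracket1 N \<gamma> u =
    e_root (2 * N) (int N * (u$1 + u$2 + u$1 * u$2) + symp (u v* \<gamma>) u)"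
proof -
  have "e_root (2 * N) (int N * k) = (- 1) powi k" for k
  proof (cases "even k")
    case True
    then show ?thesis using assms by (auto intro!: e_root_eq_1 elim!: evenE)
  next
    case False
    then obtain j where j: "k = 2 * j + 1" by (elim oddE)
    have "e_root (2 * N) (int N * k) = e_root (2 * N) (int N)"
      using assms j by (intro e_root_cong) (auto simp: algebra_simps)
    also have "\<dots> = exp (of_real pi * \<i>)" using assms by (simp add: e_root_def)
    finally show ?thesis using False by (simp add: power_int_minus_left)
  qed
  then show ?thesis by (simp add: bracket1_def e_root_add)
qed

lemma bracket1_nonzero: "bracket1 N \<gamma> u \<noteq> 0"
  by (simp add: bracket1_def)

lemma bracket1_power: "N \<ge> 1 \<Longrightarrow> bracket1 N \<gamma> u ^ (2 * N) = 1"
  by (simp add: bracket1_altdef e_root_power)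

lemma bracket2_power: "N \<ge> 1 \<Longrightarrow> bracket2 N \<gamma> u v ^ (2 * N) = 1"
  by (simp add: bracket2_altdef e_root_power)

lemma bracket2_cong:
  assumes "N \<ge> 1" "x - y \<in> Lam N \<gamma>"
  shows "bracket2 N \<gamma> x u = bracket2 N \<gamma> y u"
  unfolding bracket2_def
proof (rule e_root_cong[OF assms(1)])
  have "symp (x v* \<gamma> - x) u - symp (y v* \<gamma> - y) u =
      (((x - y) v* \<gamma>)$1 - (x - y)$1) * u$2 - (((x - y) v* \<gamma>)$2 - (x - y)$2) * u$1"
    by (simp add: symp_def vector_matrix_mult_2 algebra_simps)
  then show "int N dvd symp (x v* \<gamma> - x) u - symp (y v* \<gamma> - y) u"
    using assms(2) unfolding Lam_def by (simp only: mem_Collect_eq dvd_diff dvd_mult2)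
qed

text \<open>Follows from \<open>\<gamma> + \<gamma>\<^sup>-\<^sup>1 = N + 2\<close>; modulo \<open>2 N\<close> the exponents differ by a multiple of
  \<open>\<omega>(x, u)\<close>.\<close>

lemma bracket_reflection:
  assumes "N \<ge> 1" "\<gamma> \<in> GammaN N"
  shows "bracket2 N \<gamma> (u + u - x) u * bracket1 N \<gamma> x = bracket2 N \<gamma> x u * bracket1 N \<gamma> (u + u - x)"
proof -
  have tr: "int N = \<gamma>$1$1 + \<gamma>$2$2 - 2" using assms(2) by (simp add: GammaN_iff)
  have identity: "2 * ((y1 * a + y2 * c - y1) * u2 - (y1 * b + y2 * d - y2) * u1) +
      (n * (x1 + x2 + x1 * x2) + ((x1 * a + x2 * c) * x2 - (x1 * b + x2 * d) * x1)) -
      (2 * ((x1 * a + x2 * c - x1) * u2 - (x1 * b + x2 * d - x2) * u1) +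
      (n * (y1 + y2 + y1 * y2) + ((y1 * a + y2 * c) * y2 - (y1 * b + y2 * d) * y1))) =
      2 * n * (x1 + x2 - u1 - u2 - 2 * u1 * u2 + u1 * x2 + x1 * u2 - (x1 * u2 - x2 * u1))"
    if "n = a + d - 2" "y1 = u1 + u1 - x1" "y2 = u2 + u2 - x2"
    for n y1 y2 a b c d u1 u2 x1 x2 :: int
    unfolding that by algebra
  have "int (2 * N) dvd
      2 * symp ((u + u - x) v* \<gamma> - (u + u - x)) u +
        (int N * (x$1 + x$2 + x$1 * x$2) + symp (x v* \<gamma>) x) -
      (2 * symp (x v* \<gamma> - x) u + (int N * ((u + u - x)$1 + (u + u - x)$2 + (u + u - x)$1 * (u + u - x)$2)
         + symp ((u + u - x) v* \<gamma>) (u + u - x)))"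
    unfolding symp_def vector_minus_component vector_matrix_mult_2 vector_add_component of_nat_mult of_nat_numeral
    using identity[OF tr refl refl] by simp
  then show ?thesis
    using assms unfolding bracket1_altdef[OF assms(1)] bracket2_altdef e_root_add[symmetric]
    by (intro e_root_cong) (simp_all del: vector_minus_component vector_add_component)
qed

lemma coordinate_zero_eq:
  assumes "local_equations N X \<gamma>"
  shows "X s \<gamma> 0 = of_real (sqrt ((real N + 2 + pm s * sqrt (real N ^ 2 + 4 * real N)) / 2))"
proof -
  have "\<forall>s. X s \<gamma> 0 = of_real (sqrt ((real N + 2 + pm s * sqrt (real N ^ 2 + 4 * real N)) / 2))"
    using assms unfolding local_equations_def by (elim conjE)
  then show ?thesis by blast
qed

text \<open>The square of the coordinate at 0 is a root of \<open>t ^ 2 - (N + 2) * t + 1\<close>,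
  for either sign.\<close>

lemma coordinate_zero:
  assumes "local_equations N X \<gamma>"
  shows "X s \<gamma> 0 ^ 4 + 1 = of_nat (N + 2) * X s \<gamma> 0 ^ 2"
proof -
  define D where "D = sqrt (real N ^ 2 + 4 * real N)"
  define t where "t = (real N + 2 + pm s * D) / 2"
  have X: "X s \<gamma> 0 = of_real (sqrt t)"
    unfolding coordinate_zero_eq[OF assms] t_def D_def ..
  have D2: "D ^ 2 = real N ^ 2 + 4 * real N" by (simp add: D_def)
  have pm2: "pm s ^ 2 = 1" by (cases s) auto
  \<comment> \<open>Needed for the minus sign: \<open>t\<close> must be nonnegative for the real
    square root to square back to it.\<close>
  have "D \<le> real N + 2" unfolding D_def
    by (rule real_le_lsqrt) (auto simp: power2_eq_square algebra_simps)
  moreover have "D \<ge> 0" by (simp add: D_def)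
  ultimately have "t \<ge> 0" by (cases s) (simp_all add: t_def)
  then have "sqrt t ^ 2 = t" "sqrt t ^ 4 = t ^ 2" by (simp_all add: power4_eq_xxxx power2_eq_square)
  moreover have "t ^ 2 + 1 = real (N + 2) * t"
  proof -
    have "4 * (t ^ 2 + 1 - real (N + 2) * t) = pm s ^ 2 * D ^ 2 - (real N ^ 2 + 4 * real N)"
      by (simp add: t_def power2_eq_square field_simps)
    then show ?thesis using pm2 D2 by simp
  qed
  ultimately have "sqrt t ^ 4 + 1 = real (N + 2) * sqrt t ^ 2" by simp
  then have "complex_of_real (sqrt t ^ 4 + 1) = of_real (real (N + 2) * sqrt t ^ 2)" by simp
  then show "X s \<gamma> 0 ^ 4 + 1 = of_nat (N + 2) * X s \<gamma> 0 ^ 2" unfolding X by simp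
qed

section \<open>Consequences of the equations at a single point\<close>

context
  fixes N :: nat and X :: coords
  assumes X: "X \<in> XN_points N UNIV"
begin

lemma point_local: "\<gamma> \<in> GammaN N \<Longrightarrow> local_equations N X \<gamma>"
  using X unfolding XN_points_def by blast

lemma point_family: "coordinate_family N UNIV X"
  using X unfolding XN_points_def by blast

lemma point_periodic:
  assumes "\<gamma> \<in> GammaN N" "u - u' \<in> Lam N \<gamma>"
  shows "X s \<gamma> u = X s \<gamma> u'"
proof -
  have "\<forall>s. \<forall>\<gamma>\<in>GammaN N. \<forall>u. \<forall>u'. u - u' \<in> Lam N \<gamma> \<longrightarrow> X s \<gamma> u = X s \<gamma> u'"
    using point_family unfolding coordinate_family_def by (elim conjE)
  then show ?thesis using assms by blast
qed

lemma point_Minus: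
  assumes "\<gamma> \<in> GammaN N" "u \<notin> Lam N \<gamma>"
  shows "X Minus \<gamma> u = X Plus \<gamma> u"
proof -
  have "\<forall>\<gamma>\<in>GammaN N. \<forall>u. u \<notin> Lam N \<gamma> \<longrightarrow> X Plus \<gamma> u = X Minus \<gamma> u"
    using point_family unfolding coordinate_family_def by (elim conjE)
  then show ?thesis using assms by metis
qed

lemma point_conj:
  assumes "\<gamma> \<in> GammaN N" "\<delta> \<in> SL2Z" "\<delta> ** \<gamma> ** matrix_inv \<delta> \<in> GammaN N"
  shows "X s \<gamma> u = X s (\<delta> ** \<gamma> ** matrix_inv \<delta>) (u v* matrix_inv \<delta>)"
proof -
  have "\<forall>s. \<forall>\<gamma>\<in>GammaN N. \<forall>\<delta>\<in>SL2Z. \<delta> ** \<gamma> ** matrix_inv \<delta> \<in> GammaN N \<longrightarrow>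
      (\<forall>u. X s (\<delta> ** \<gamma> ** matrix_inv \<delta>) (u v* matrix_inv \<delta>) = X s \<gamma> u)"
    using point_family unfolding coordinate_family_def by (elim conjE)
  then show ?thesis using assms by simp
qed

lemma point_inverse:
  assumes "\<gamma> \<in> GammaN N"
  shows "X Plus \<gamma> u * X Minus \<gamma> (- u) = inverse (bracket1 N \<gamma> u)"
proof -
  have "\<forall>u. X Plus \<gamma> u * X Minus \<gamma> (- u) = inverse (bracket1 N \<gamma> u)"
    using point_local[OF assms] unfolding local_equations_def by (elim conjE)
  then show ?thesis by blast
qed

lemma point_nonzero: "\<gamma> \<in> GammaN N \<Longrightarrow> X s \<gamma> u \<noteq> 0"
  using point_inverse[of \<gamma> u] point_inverse[of \<gamma> "- u"] bracket1_nonzero[of N \<gamma>]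
  by (cases s) auto

text \<open>Turns quotients of coordinates into products of a root of unity and coordinates, which
  can be compared with a coordinate of largest size.\<close>

lemma point_inverse_Minus:
  assumes "\<gamma> \<in> GammaN N"
  shows "1 / X Minus \<gamma> u = bracket1 N \<gamma> (- u) * X Plus \<gamma> (- u)"
  using point_inverse[OF assms, of "- u"] point_nonzero[OF assms, of Minus u] bracket1_nonzero[of N \<gamma> "- u"]
  by (simp add: field_simps)

text \<open>The shift by \<open>- (u + u)\<close> makes each summand a root of unity times
  \<open>X Plus \<gamma> x * X Plus \<gamma> (u + u - x)\<close>, a product invariant under the
  reflection of \<open>x\<close>.\<close>

lemma point_quadratic_sum:
  assumes "\<gamma> \<in> GammaN N" "u \<notin> Lam N \<gamma>" "N \<ge> 1"
  shows "sum_G N \<gamma> (\<lambda>x. bracket2 N \<gamma> x u * (X Plus \<gamma> x / X Minus \<gamma> (x - (u + u)))) =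
    of_real (sqrt (real N)) * (X Plus \<gamma> (- u) / (X Minus \<gamma> u * X Minus \<gamma> (- (u + u))))"
proof -
  have eq: "\<forall>u v. \<not> (u \<in> Lam N \<gamma> \<and> v \<in> Lam N \<gamma>) \<longrightarrow>
        1 / of_real (sqrt (real N)) *
          sum_G N \<gamma> (\<lambda>x. bracket2 N \<gamma> x u * (X Plus \<gamma> x / X Minus \<gamma> (x + v)))
        = X Plus \<gamma> (u + v) / (X Minus \<gamma> u * X Minus \<gamma> v)"
    using point_local[OF assms(1)] unfolding local_equations_def by (elim conjE)
  have "of_real (sqrt (real N)) \<noteq> (0::complex)" using assms(3) by simp
  then show ?thesis using eq[rule_format, of u "- (u + u)"] assms(2) by (simp add: field_simps)
qed

end

text \<open>For the order-two relation the multiplier ratio \<open>\<mu>\<^sub>\<gamma>\<^sup>2 / \<mu>\<^sub>\<gamma>\<^sub>'\<close> is eliminated by comparing with the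
  same relation at \<open>p = 0\<close>.\<close>

lemma order_two_relation:
  assumes N: "N \<ge> 1" and \<gamma>: "\<gamma> \<in> GammaN N" and s: "s \<notin> Lam N \<gamma>" "s + s \<in> Lam N \<gamma>"
  obtains \<gamma>' q where "\<gamma>' \<in> GammaN N"
    "\<And>X p. X \<in> XN_points N UNIV \<Longrightarrow> X Plus \<gamma> (p + s) * X Plus \<gamma> p = X Plus \<gamma> s * X Plus \<gamma>' (q p)"
proof -
  obtain \<gamma>' h y x w f where \<gamma>': "\<gamma>' \<in> GammaN N" and params: "dist_params \<gamma> s h y x w f"
    "rat_mat \<gamma>' = dist_matrix \<gamma> h y f"
    using order_two_isogeny[OF \<gamma> N s] by blast
  define q where "q p = vec2 (int h * p$1) (int y * p$2 - f * p$1)" for p :: "int^2"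
  show ?thesis
  proof
    fix X p assume X: "X \<in> XN_points N UNIV"
    have rel: "mu \<gamma> powi (- 2) * (X Plus \<gamma> (p + s) * X Plus \<gamma> p) = inverse (mu \<gamma>') * X Plus \<gamma>' (q p)" for p
    proof -
      have *: "mu \<gamma> powi (- int (ord_G N \<gamma> s)) *
          (\<Prod>n = 1..ord_G N \<gamma> s. X Plus \<gamma> (p + of_nat n *s s)) = inverse (mu \<gamma>') * X Plus \<gamma>' (q p)"
      proof -
        have "distribution_relations N X \<gamma>" using X \<gamma> by (simp add: XN_points_def)
        then show ?thesis using \<gamma>' params unfolding distribution_relations_def q_def by metis
      qed
      have "{1..2::nat} = {1, 2}" by auto
      moreover have "p + of_nat 1 *s s = p + s" "p + of_nat 2 *s s = p + (s + s)"
        by (simp_all add: vec_eq_2)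
      moreover have "X Plus \<gamma> (p + (s + s)) = X Plus \<gamma> p"
        using s by (intro point_periodic[OF X \<gamma>]) simp
      ultimately show ?thesis using * unfolding ord_G_eq_2[OF s] by simp
    qed
    \<comment> \<open>At \<open>p = 0\<close> both sides involve a coordinate at 0, whose value
      depends only on \<open>N\<close> and the sign; cancelling it expresses the multiplier ratio by
      \<open>X Plus \<gamma> s\<close>.\<close>
    have "q 0 = 0" by (simp add: q_def vec_eq_2)
    moreover have "X Plus \<gamma>' 0 = X Plus \<gamma> 0"
      by (simp only: coordinate_zero_eq[OF point_local[OF X \<gamma>']] coordinate_zero_eq[OF point_local[OF X \<gamma>]])
    ultimately have "mu \<gamma> powi (- 2) * X Plus \<gamma> s = inverse (mu \<gamma>')"
      using rel[of 0] point_nonzero[OF X \<gamma>, of Plus 0] by simp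
    then have "mu \<gamma> powi (- 2) * (X Plus \<gamma> (p + s) * X Plus \<gamma> p) =
        mu \<gamma> powi (- 2) * (X Plus \<gamma> s * X Plus \<gamma>' (q p))"
      using rel[of p] by (simp add: mult.assoc)
    then show "X Plus \<gamma> (p + s) * X Plus \<gamma> p = X Plus \<gamma> s * X Plus \<gamma>' (q p)"
      using mu_nonzero[OF \<gamma>] by simp
  qed (rule \<gamma>')
qed

lemma finite_preorder_greatest:
  assumes "finite C" "C \<noteq> {}"
    and total: "\<And>a b. a \<in> C \<Longrightarrow> b \<in> C \<Longrightarrow> R a b \<or> R b a"
    and trans: "\<And>a b c. a \<in> C \<Longrightarrow> b \<in> C \<Longrightarrow> c \<in> C \<Longrightarrow> R a b \<Longrightarrow> R b c \<Longrightarrow> R a c"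
  shows "\<exists>t\<in>C. \<forall>c\<in>C. R c t"
  using assms
proof (induction rule: finite_ne_induct)
  case (singleton x)
  have "R x x" using singleton.prems(1)[of x x] by simp
  then show ?case by simp
next
  case (insert x C)
  have "\<exists>t\<in>C. \<forall>c\<in>C. R c t"
  proof (rule insert.IH)
    show "R a b \<or> R b a" if "a \<in> C" "b \<in> C" for a b
      using insert.prems(1)[of a b] that by simp
    show "R a c" if "a \<in> C" "b \<in> C" "c \<in> C" "R a b" "R b c" for a b c
      using insert.prems(2)[of a b c] that by simp
  qed
  then obtain t where t: "t \<in> C" "\<forall>c\<in>C. R c t" by blast
  show ?case
  proof (cases "R x t")
    case False
    then have "R t x" using insert.prems(1)[of x t] t by auto
    moreover have "R x x" using insert.prems(1)[of x x] by simp
    moreover have "R c x" if "c \<in> C" "R t x" for c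
      using insert.prems(2)[of c t x] that t by simp
    ultimately have "\<forall>c\<in>insert x C. R c x" by simp
    then show ?thesis by blast
  qed (use t in auto)
qed

section \<open>Sums over the quotient and reduced coordinates\<close>

text \<open>All points are treated at once in a ring of functions; this and the next lemmas reduce
  identities there to pointwise ones.\<close>

lemma of_nat_fun_apply: "(of_nat n :: 'a \<Rightarrow> 'b::semiring_1) x = of_nat n"
  by (induction n) simp_all

lemma of_int_fun_apply: "(of_int k :: 'a \<Rightarrow> 'b::ring_1) x = of_int k"
  by (cases k rule: int_cases2) (simp_all add: of_nat_fun_apply)

lemma power_fun_apply: "(f ^ n) x = f x ^ n" for f :: "'a \<Rightarrow> 'b::monoid_mult"
  by (induction n) simp_all

lemma sum_fun_apply: "(\<Sum>i\<in>S. f i) x = (\<Sum>i\<in>S. f i x)" for f :: "'c \<Rightarrow> 'a \<Rightarrow> 'b::comm_monoid_add"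
  by (induction S rule: infinite_finite_induct) simp_all

text \<open>The reflection \<open>x \<mapsto> v - x\<close> acts on the classes and fixes that of
  \<open>u\<close>. The sum over the other classes lies in \<open>I\<close> by pairing, so the one
  remaining term does as well.\<close>

lemma sum_quotient_involution_mem_ideal:
  assumes AI: "subring_ideal A I" "2 \<in> I" and N: "N \<ge> 1"
    and periodic: "\<And>x y. x - y \<in> Lam N \<gamma> \<Longrightarrow> F x = F y"
    and mem: "\<And>x. F x \<in> A"
    and refl: "\<And>x. F (v - x) = F x"
    and fixed: "\<And>x. (v - x) - x \<in> Lam N \<gamma> \<Longrightarrow> x - u \<notin> Lam N \<gamma> \<Longrightarrow> F x \<in> I"
    and u: "(v - u) - u \<in> Lam N \<gamma>"
    and total: "(\<Sum>C\<in>G_quot N \<gamma>. F (SOME x. x \<in> C)) \<in> I"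
  shows "F u \<in> I"
proof -
  interpret subring_ideal A I by fact
  define R where "R = {(u, u'). u - u' \<in> Lam N \<gamma>}"
  define rep :: "(int^2) set \<Rightarrow> int^2" where "rep C = (SOME x. x \<in> C)" for C
  define cls where "cls x = R `` {x}" for x
  have eqv: "equiv UNIV R" unfolding R_def by (rule equiv_Lam)
  have G: "G_quot N \<gamma> = range cls" by (auto simp: G_quot_def quotient_def cls_def R_def)
  have cls_eq: "cls x = cls y \<longleftrightarrow> x - y \<in> Lam N \<gamma>" for x y
    unfolding cls_def using eq_equiv_class_iff[OF eqv, of x y] by (simp add: R_def)
  have cls_rep: "cls (rep (cls x)) = cls x" for x
  proof -
    have "x \<in> cls x" unfolding cls_def by (rule equiv_class_self[OF eqv]) simp
    then have "rep (cls x) \<in> cls x" unfolding rep_def by (rule someI)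
    then show ?thesis unfolding cls_def using equiv_class_eq[OF eqv, of x "rep (cls x)"] by (simp add: cls_def)
  qed
  have cls_reflect: "cls (v - x) = cls (v - y)" if "cls x = cls y" for x y
    using that Lam_uminus[of "x - y" N \<gamma>] unfolding cls_eq by simp
  have F_cls: "F x = F y" if "cls x = cls y" for x y
    using that periodic unfolding cls_eq by blast
  define \<tau> where "\<tau> C = cls (v - rep C)" for C
  have \<tau>: "\<tau> (cls x) = cls (v - x)" for x
    unfolding \<tau>_def by (rule cls_reflect) (rule cls_rep)
  have uu: "cls (v - u) = cls u" using u by (simp add: cls_eq)
  \<comment> \<open>The class of \<open>u\<close> can be left out because it is fixed, so the
    remaining classes are stable under \<open>\<tau>\<close>.\<close>
  have "(\<Sum>C\<in>G_quot N \<gamma> - {cls u}. F (rep C)) \<in> I"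
  proof (rule sum_involution_mem_ideal[where \<tau> = \<tau>])
    show "finite (G_quot N \<gamma> - {cls u})" using finite_G_quot[OF N] by simp
    show "2 \<in> I" by fact
  next
    fix C assume "C \<in> G_quot N \<gamma> - {cls u}"
    then obtain x where x: "C = cls x" "cls x \<noteq> cls u" unfolding G by blast
    have "\<tau> C \<noteq> cls u"
    proof
      assume "\<tau> C = cls u"
      then have "cls (v - (v - x)) = cls (v - u)" using x \<tau> by (intro cls_reflect) simp
      then show False using uu x by simp
    qed
    moreover have "F (rep (\<tau> C)) = F (rep C)"
    proof -
      have "F (rep (\<tau> C)) = F (v - x)" by (rule F_cls) (simp add: x \<tau> cls_rep)
      also have "\<dots> = F x" by (rule refl)
      also have "\<dots> = F (rep C)" by (rule F_cls) (simp add: x cls_rep)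
      finally show ?thesis .
    qed
    ultimately show "\<tau> C \<in> G_quot N \<gamma> - {cls u} \<and> \<tau> (\<tau> C) = C \<and> F (rep (\<tau> C)) = F (rep C) \<and> F (rep C) \<in> A"
      using x mem by (auto simp: G \<tau>)
    assume "\<tau> C = C"
    then have "cls (v - rep C) = cls (rep C)" using x by (simp add: \<tau>_def cls_rep)
    then have "(v - rep C) - rep C \<in> Lam N \<gamma>" by (simp only: cls_eq)
    moreover have "rep C - u \<notin> Lam N \<gamma>"
      unfolding cls_eq[symmetric] using x cls_rep[of x] by simp
    ultimately show "F (rep C) \<in> I" by (rule fixed)
  qed
  moreover have "(\<Sum>C\<in>G_quot N \<gamma>. F (rep C)) = F u + (\<Sum>C\<in>G_quot N \<gamma> - {cls u}. F (rep C))"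
    using finite_G_quot[OF N, of \<gamma>] F_cls[of "rep (cls u)" u] cls_rep[of u]
    by (subst sum.remove[of _ "cls u"]) (auto simp: G)
  ultimately have "F u = (\<Sum>C\<in>G_quot N \<gamma>. F (rep C)) + - (\<Sum>C\<in>G_quot N \<gamma> - {cls u}. F (rep C))"
    "- (\<Sum>C\<in>G_quot N \<gamma> - {cls u}. F (rep C)) \<in> I"
    using uminus_mem_ideal by simp_all
  then show ?thesis using total add_mem_ideal unfolding rep_def by metis
qed

text \<open>A finite set of indices that reaches every coordinate, possibly several times.\<close>

definition reduced_indices :: "nat \<Rightarrow> ((int^2^2) \<times> (int^2)) set" where
  "reduced_indices N =
    {\<gamma> \<in> GammaN N. \<forall>i j. \<bar>\<gamma>$i$j\<bar> \<le> (int N + 2)\<^sup>2} \<times> {u :: int^2. \<forall>i. u$i \<in> {0..int N}}"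

lemma finite_reduced_indices: "finite (reduced_indices N)"
proof -
  let ?M = "(int N + 2)\<^sup>2"
  have "{\<gamma> :: int^2^2. \<forall>i j. \<bar>\<gamma>$i$j\<bar> \<le> ?M} \<subseteq>
      (\<lambda>(r, s). vec2 r s) ` ({u. \<forall>i. u$i \<in> {-?M..?M}} \<times> {u. \<forall>i. u$i \<in> {-?M..?M}})"
  proof
    fix \<gamma> :: "int^2^2" assume *: "\<gamma> \<in> {\<gamma>. \<forall>i j. \<bar>\<gamma>$i$j\<bar> \<le> ?M}"
    have "\<gamma>$i$j \<in> {-?M..?M}" for i j
    proof -
      have "\<bar>\<gamma>$i$j\<bar> \<le> ?M" using * by blast
      then show ?thesis by (auto simp: abs_le_iff)
    qed
    moreover have "\<gamma> = vec2 (\<gamma>$1) (\<gamma>$2)" by (simp add: vec_eq_2[of \<gamma>])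
    ultimately show "\<gamma> \<in> (\<lambda>(r, s). vec2 r s) ` ({u. \<forall>i. u$i \<in> {-?M..?M}} \<times> {u. \<forall>i. u$i \<in> {-?M..?M}})"
      by (intro image_eqI[where x = "(\<gamma>$1, \<gamma>$2)"]) auto
  qed
  then have "finite {\<gamma> :: int^2^2. \<forall>i j. \<bar>\<gamma>$i$j\<bar> \<le> ?M}"
    by (rule finite_subset) (intro finite_imageI finite_cartesian_product finite_int_box)
  then have "finite {\<gamma> \<in> GammaN N. \<forall>i j. \<bar>\<gamma>$i$j\<bar> \<le> ?M}"
    by (rule rev_finite_subset) blast
  then show ?thesis unfolding reduced_indices_def by (intro finite_cartesian_product finite_int_box)
qed

text \<open>Combines conjugation to a matrix of bounded entries with reduction of the vector modulo
  \<open>N\<close>. The new index is chosen before the point, hence is the same for all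
  points.\<close>

lemma reduced_index_exists:
  assumes "N \<ge> 1" "\<gamma> \<in> GammaN N"
  obtains \<beta> v where "(\<beta>, v) \<in> reduced_indices N"
    "\<And>X s. X \<in> XN_points N UNIV \<Longrightarrow> X s \<gamma> u = X s \<beta> v"
proof -
  obtain \<delta> where \<delta>: "\<delta> \<in> SL2Z" "\<delta> ** \<gamma> ** matrix_inv \<delta> \<in> GammaN N"
    "\<forall>i j. \<bar>(\<delta> ** \<gamma> ** matrix_inv \<delta>)$i$j\<bar> \<le> (int N + 2)\<^sup>2"
    using GammaN_reduction[OF assms(2,1)] by blast
  define \<beta> where "\<beta> = \<delta> ** \<gamma> ** matrix_inv \<delta>"
  obtain v :: "int^2" where v: "\<And>i. v$i \<in> {0..int N}" "u v* matrix_inv \<delta> - v \<in> Lam N \<beta>"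
    using Lam_representative[OF assms(1)] by blast
  show ?thesis
  proof
    show "(\<beta>, v) \<in> reduced_indices N"
      using \<delta> v(1) by (auto simp: reduced_indices_def \<beta>_def simp del: atLeastAtMost_iff)
    fix X s assume X: "X \<in> XN_points N UNIV"
    have "X s \<gamma> u = X s \<beta> (u v* matrix_inv \<delta>)"
      unfolding \<beta>_def by (rule point_conj[OF X assms(2) \<delta>(1,2)])
    also have "\<dots> = X s \<beta> v"
      using v(2) \<delta>(2) by (intro point_periodic[OF X]) (simp_all add: \<beta>_def)
    finally show "X s \<gamma> u = X s \<beta> v" .
  qed
qed

section \<open>Integrality at 2\<close>

text \<open>Multiplied by the \<open>n\<close>-th power of the coordinate, the equation has the odd
  leading coefficient \<open>1 - a 0\<close>, so it expresses integrality at 2. Arguing with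
  functions of the point gives the same coefficients for all points.\<close>

lemma coordinate_integrality:
  assumes N: "N \<ge> 1" and \<gamma>0: "\<gamma>0 \<in> GammaN N"
  shows "\<exists>n a. even (a 0 :: int) \<and>
    (\<forall>X\<in>XN_points N UNIV. (\<Sum>i\<le>n. of_int (a i) * inverse (X Plus \<gamma>0 u0) ^ i) = 1)"
proof (cases "XN_points N UNIV = {}")
  case True
  then show ?thesis by (intro exI[of _ 0] exI[of _ "\<lambda>_. 0"]) simp
next
  case False
  then obtain X0 where X0: "X0 \<in> XN_points N UNIV" by blast
  \<comment> \<open>Functions are defined on all families; arguments that are not points are sent to
    \<open>X0\<close>, so that the equations hold at every argument.\<close>
  define \<rho> where "\<rho> X = (if X \<in> XN_points N UNIV then X else X0)" for X
  have \<rho>: "\<rho> X \<in> XN_points N UNIV" for X using X0 by (simp add: \<rho>_def)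
  define c :: "int^2^2 \<Rightarrow> int^2 \<Rightarrow> coords \<Rightarrow> complex" where "c \<gamma> u X = \<rho> X Plus \<gamma> u" for \<gamma> u X
  \<comment> \<open>\<open>u\<close> is the pointwise inverse, written explicitly since the function
    ring is not a field; \<open>K\<close> embeds the constants.\<close>
  define u :: "(coords \<Rightarrow> complex) \<Rightarrow> coords \<Rightarrow> complex" where "u y X = inverse (y X)" for y X
  define K :: "complex \<Rightarrow> coords \<Rightarrow> complex" where "K z X = z" for z X
  note [simp] = of_nat_fun_apply of_int_fun_apply power_fun_apply sum_fun_apply
  have nz: "c \<gamma> v X \<noteq> 0" if "\<gamma> \<in> GammaN N" for \<gamma> v X
    unfolding c_def using \<rho> that by (rule point_nonzero)
  define \<xi> where "\<xi> = c \<gamma>0 u0"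
  show ?thesis
  proof (rule ccontr)
    assume neg: "\<not> ?thesis"
    have "(\<Sum>i\<le>n. of_int (a i) * u \<xi> ^ i) \<noteq> 1" if "even (a 0 :: int)" for n a
    proof
      assume *: "(\<Sum>i\<le>n. of_int (a i) * u \<xi> ^ i) = 1"
      have "(\<Sum>i\<le>n. of_int (a i) * inverse (X Plus \<gamma>0 u0) ^ i) = 1" if "X \<in> XN_points N UNIV" for X
        using fun_cong[OF *, of X] that by (simp add: u_def \<xi>_def c_def \<rho>_def)
      then show False using neg that by blast
    qed
    from subring_ideal_even_constant_term[OF this] obtain A0 I0 where AI0:
      "subring_ideal A0 I0" "1 \<notin> I0" "2 \<in> I0" "u \<xi> \<in> I0" by blast
    define C where "C = (\<lambda>(\<gamma>, v). c \<gamma> v) ` reduced_indices N"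
    have "finite C" unfolding C_def by (intro finite_imageI finite_reduced_indices)
    have c_mem: "c \<gamma> v \<in> C" if "\<gamma> \<in> GammaN N" for \<gamma> v
    proof -
      obtain \<beta> v' where "(\<beta>, v') \<in> reduced_indices N"
        "\<And>X s. X \<in> XN_points N UNIV \<Longrightarrow> X s \<gamma> v = X s \<beta> v'"
        using reduced_index_exists[OF N \<open>\<gamma> \<in> GammaN N\<close>] by blast
      then have "c \<gamma> v = (\<lambda>(\<gamma>, v). c \<gamma> v) (\<beta>, v')" using \<rho> by (simp add: c_def fun_eq_iff)
      then show ?thesis unfolding C_def using \<open>(\<beta>, v') \<in> reduced_indices N\<close> by blast
    qed
    have C_D: "\<exists>\<gamma>\<in>GammaN N. \<exists>v. y = c \<gamma> v" if "y \<in> C" for y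
      using that by (auto simp: C_def reduced_indices_def)
    have C_nz: "y X \<noteq> 0" if "y \<in> C" for y X
      using C_D[OF that] nz by auto
    \<comment> \<open>The finitely many units to be compared: coordinates, their ratios, the
      \<open>2 * N\<close>-th roots of unity and the square root of \<open>N\<close>.\<close>
    define Y where "Y = C \<union> (\<lambda>(y, y'). y * u y') ` (C \<times> C) \<union> K ` {z. z ^ (2 * N) = 1} \<union>
      {K (of_real (sqrt (real N)))}"
    have "finite {z :: complex. z ^ (2 * N) = 1}" using N by (intro finite_roots_unity) simp
    then have "finite Y" using \<open>finite C\<close> unfolding Y_def by simp
    moreover have "y * u y = 1" if "y \<in> Y" for y
    proof -
      have "y X \<noteq> 0" for X
      proof -
        have "z \<noteq> 0" if "z ^ (2 * N) = 1" for z :: complex using that N by (auto simp: power_0_left)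
        then show ?thesis using that N unfolding Y_def by (auto simp: C_nz u_def K_def)
      qed
      then show ?thesis by (simp add: u_def fun_eq_iff)
    qed
    ultimately obtain A I where AI: "A0 \<subseteq> A" "I0 \<subseteq> I" "subring_ideal A I" "1 \<notin> I"
      and Y: "\<And>y. y \<in> Y \<Longrightarrow> y \<in> A \<or> u y \<in> A"
      using chevalley_extension_finite[OF _ AI0(1,2), of Y u] by blast
    interpret subring_ideal A I by fact
    \<comment> \<open>This and the next two memberships write an element of \<open>Y\<close> as a
      polynomial in its own inverse, so that it lies in \<open>A\<close> whichever of the two
      does.\<close>
    have root_mem: "K z \<in> A" if "z ^ (2 * N) = 1" for z
    proof -
      have "K z = u (K z) ^ (2 * N - 1)"
      proof
        have "z \<noteq> 0" using that N by (auto simp: power_0_left)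
        moreover have "z ^ (2 * N) = z * z ^ (2 * N - 1)" using N by (simp flip: power_Suc)
        ultimately show "K z X = (u (K z) ^ (2 * N - 1)) X" for X
          using that by (simp add: K_def u_def field_simps)
      qed
      moreover have "K z \<in> Y" using that by (simp add: Y_def)
      ultimately show ?thesis using Y[of "K z"] power_mem[of "u (K z)"] by metis
    qed
    have sqrt_mem: "K (of_real (sqrt (real N))) \<in> A"
    proof -
      let ?r = "of_real (sqrt (real N)) :: complex"
      have "?r * ?r = of_nat N" by (simp flip: of_real_mult)
      then have "K ?r = of_nat N * u (K ?r)"
        using N by (simp add: K_def u_def fun_eq_iff field_simps)
      moreover have "K ?r \<in> Y" by (simp add: Y_def)
      ultimately show ?thesis using Y[of "K ?r"] mult_mem[OF of_nat_mem] by metis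
    qed
    have zero_mem': "c \<gamma> 0 \<in> A" if "\<gamma> \<in> GammaN N" for \<gamma>
    proof -
      have "c \<gamma> 0 = (of_nat (N + 2) - u (c \<gamma> 0) ^ 2) * u (c \<gamma> 0)"
      proof
        fix X
        have "c \<gamma> 0 X ^ 4 + 1 = of_nat (N + 2) * c \<gamma> 0 X ^ 2"
          unfolding c_def by (rule coordinate_zero[OF point_local[OF \<rho> that]])
        moreover have "z = (n - inverse z ^ 2) * inverse z" if "z ^ 4 + 1 = n * z ^ 2" "z \<noteq> 0" for z n :: complex
        proof -
          have "n * z ^ 2 - 1 = z ^ 4" using that(1) by (simp add: algebra_simps)
          then have "(n * z ^ 2 - 1) / z ^ 3 = z"
            using that(2) by (simp add: power4_eq_xxxx power3_eq_cube)
          then show ?thesis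
            using that(2) by (simp add: power2_eq_square power3_eq_cube field_simps)
        qed
        ultimately show "c \<gamma> 0 X = ((of_nat (N + 2) - u (c \<gamma> 0) ^ 2) * u (c \<gamma> 0)) X"
          using nz[OF that, of 0 X] by (simp add: u_def del: of_nat_add)
      qed
      moreover have "c \<gamma> 0 \<in> Y" using c_mem[OF that] by (simp add: Y_def)
      ultimately show ?thesis
        using Y[of "c \<gamma> 0"] mult_mem diff_mem[OF of_nat_mem power_mem] by metis
    qed
    \<comment> \<open>Read \<open>a * u b \<in> A\<close> as saying that \<open>a\<close> is at most
      as large as \<open>b\<close>; the relation is total because the ratios belong to
      \<open>Y\<close>.\<close>
    have "\<exists>t\<in>C. \<forall>y\<in>C. y * u t \<in> A"
    proof (rule finite_preorder_greatest)
      show "C \<noteq> {}" using c_mem[OF \<gamma>0] by blast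
    next
      fix a b assume "a \<in> C" "b \<in> C"
      moreover from this have "u (a * u b) = b * u a" by (simp add: u_def fun_eq_iff field_simps C_nz)
      moreover have "a * u b \<in> Y" using \<open>a \<in> C\<close> \<open>b \<in> C\<close> by (auto simp: Y_def)
      ultimately show "a * u b \<in> A \<or> b * u a \<in> A" using Y[of "a * u b"] by metis
    next
      fix a b d assume "a \<in> C" "b \<in> C" "d \<in> C" "a * u b \<in> A" "b * u d \<in> A"
      moreover have "(a * u b) * (b * u d) = a * u d"
        using \<open>b \<in> C\<close> by (simp add: u_def fun_eq_iff C_nz)
      ultimately show "a * u d \<in> A" using mult_mem by metis
    qed (rule \<open>finite C\<close>)
    then obtain t where t: "t \<in> C" "\<And>y. y \<in> C \<Longrightarrow> y * u t \<in> A" by blast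
    \<comment> \<open>From here on, \<open>v\<close> is the index of the largest coordinate
      \<open>t\<close>.\<close>
    then obtain \<gamma> v where \<gamma>: "\<gamma> \<in> GammaN N" and t_eq: "t = c \<gamma> v" using C_D by blast
    have tt: "t * u t = 1" by (simp add: u_def fun_eq_iff C_nz[OF t(1)])
    have t_inv: "u t \<in> I"
    proof -
      have "(\<xi> * u t) * u \<xi> = u t" by (simp add: u_def \<xi>_def fun_eq_iff nz[OF \<gamma>0])
      then show ?thesis
        using mult_mem_ideal[OF t(2)[of \<xi>], of "u \<xi>"] AI0(4) AI(2) c_mem[OF \<gamma>0] by (auto simp: \<xi>_def)
    qed
    \<comment> \<open>Otherwise \<open>t\<close> would be a coordinate at 0, hence in
      \<open>A\<close>, and \<open>t * u t = 1\<close> would lie in \<open>I\<close>.\<close>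
    have v: "v \<notin> Lam N \<gamma>"
    proof
      assume "v \<in> Lam N \<gamma>"
      then have "c \<gamma> v = c \<gamma> 0"
        using point_periodic[OF \<rho> \<gamma>, of v 0] by (simp add: c_def fun_eq_iff)
      then have "t * u t \<in> I" using zero_mem'[OF \<gamma>] t_inv mult_mem_ideal t_eq by metis
      then show False using tt AI(4) by simp
    qed
    have two_torsion: "c \<gamma> x * u t \<in> I" if x: "(v + v - x) - x \<in> Lam N \<gamma>" "x - v \<notin> Lam N \<gamma>" for x
    proof -
      define s where "s = x - v"
      have "- ((v + v - x) - x) = s + s" by (simp add: s_def)
      then have s: "s \<notin> Lam N \<gamma>" "s + s \<in> Lam N \<gamma>"
        using x Lam_uminus[OF x(1)] by (simp_all add: s_def)
      obtain \<gamma>' q where \<gamma>': "\<gamma>' \<in> GammaN N" and rel: "\<And>X p. X \<in> XN_points N UNIV \<Longrightarrow>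
          X Plus \<gamma> (p + s) * X Plus \<gamma> p = X Plus \<gamma> s * X Plus \<gamma>' (q p)"
        using order_two_relation[OF N \<gamma> s] by blast
      have "c \<gamma> x X * t X = c \<gamma> s X * c \<gamma>' (q v) X" for X
        using rel[OF \<rho>, of X v] by (simp add: c_def t_eq s_def)
      then have "c \<gamma> x * u t = (c \<gamma> s * (c \<gamma>' (q v) * u t)) * u t"
        using C_nz[OF t(1)] by (simp add: u_def fun_eq_iff field_simps)
      \<comment> \<open>As \<open>- s\<close> and \<open>s\<close> are in the same class, the square
        of this coordinate is a root of unity.\<close>
      moreover have "c \<gamma> s \<in> A"
      proof -
        have "- s \<notin> Lam N \<gamma>" using s Lam_uminus[of "- s"] by auto
        have "c \<gamma> s X * c \<gamma> s X = inverse (bracket1 N \<gamma> s)" for X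
        proof -
          have "- s - s \<in> Lam N \<gamma>" using Lam_uminus[OF s(2)] by simp
          then have "\<rho> X Minus \<gamma> (- s) = \<rho> X Plus \<gamma> s"
            using point_Minus[OF \<rho> \<gamma> \<open>- s \<notin> Lam N \<gamma>\<close>] point_periodic[OF \<rho> \<gamma>, of "- s" s] by simp
          then show ?thesis using point_inverse[OF \<rho> \<gamma>, of X s] by (simp add: c_def)
        qed
        then have "c \<gamma> s = K (inverse (bracket1 N \<gamma> s)) * u (c \<gamma> s)"
          using nz[OF \<gamma>, of s] by (simp add: K_def u_def fun_eq_iff eq_divide_eq flip: divide_inverse)
        moreover have "K (inverse (bracket1 N \<gamma> s)) \<in> A"
          by (rule root_mem) (simp add: bracket1_power[OF N] power_inverse)
        moreover have "c \<gamma> s \<in> Y" using c_mem[OF \<gamma>] by (simp add: Y_def)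
        ultimately show ?thesis using Y[of "c \<gamma> s"] mult_mem by metis
      qed
      ultimately show ?thesis
        using t(2)[OF c_mem[OF \<gamma>']] t_inv by (simp only: mult_mem mult_mem_ideal)
    qed
    \<comment> \<open>The summand of the quadratic equation with shift \<open>- (v + v)\<close>,
      divided by the square of \<open>t\<close>.\<close>
    define F where "F x X = bracket2 N \<gamma> x v * (\<rho> X Plus \<gamma> x / \<rho> X Minus \<gamma> (x - (v + v))) * inverse (t X) ^ 2"
      for x X
    have F_eq: "F x = (K (bracket2 N \<gamma> x v * bracket1 N \<gamma> (v + v - x)) * (c \<gamma> (v + v - x) * u t)) * (c \<gamma> x * u t)"
      for x
    proof
      fix X
      have "F x X = bracket2 N \<gamma> x v * (\<rho> X Plus \<gamma> x * (1 / \<rho> X Minus \<gamma> (x - (v + v)))) * inverse (t X) ^ 2"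
        by (simp add: F_def)
      also have "\<dots> = bracket2 N \<gamma> x v * (\<rho> X Plus \<gamma> x * (bracket1 N \<gamma> (v + v - x) * \<rho> X Plus \<gamma> (v + v - x))) *
          inverse (t X) ^ 2"
        by (subst point_inverse_Minus[OF \<rho> \<gamma>]) simp
      finally show "F x X = ((K (bracket2 N \<gamma> x v * bracket1 N \<gamma> (v + v - x)) * (c \<gamma> (v + v - x) * u t)) *
          (c \<gamma> x * u t)) X"
        by (simp add: K_def u_def c_def power2_eq_square)
    qed
    have roots: "K (bracket2 N \<gamma> x v * bracket1 N \<gamma> y) \<in> A" for x y
      by (rule root_mem) (simp add: power_mult_distrib bracket1_power[OF N] bracket2_power[OF N])
    have ratio: "c \<gamma> x * u t \<in> A" for x using t(2) c_mem[OF \<gamma>] by blast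
    have "F v \<in> I"
    proof (rule sum_quotient_involution_mem_ideal[OF AI(3) _ N, where v = "v + v"])
      show "2 \<in> I" using AI0(3) AI(2) by blast
      show "F x \<in> A" for x
        unfolding F_eq by (rule mult_mem[OF mult_mem[OF roots ratio] ratio])
      show "F x = F y" if "x - y \<in> Lam N \<gamma>" for x y
      proof
        fix X
        have "x - (v + v) - (y - (v + v)) \<in> Lam N \<gamma>" using that by simp
        then show "F x X = F y X"
          unfolding F_def using bracket2_cong[OF N that] point_periodic[OF \<rho> \<gamma>] that by metis
      qed
      show "F (v + v - x) = F x" for x
        unfolding F_eq using bracket_reflection[OF N \<gamma>, of v x] by (simp add: mult_ac)
      show "F x \<in> I" if "(v + v - x) - x \<in> Lam N \<gamma>" "x - v \<notin> Lam N \<gamma>" for x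
        unfolding F_eq by (rule mult_mem_ideal[OF mult_mem[OF roots ratio] two_torsion[OF that]])
      show "(v + v - v) - v \<in> Lam N \<gamma>" by (simp add: Lam_zero)
      \<comment> \<open>The right-hand side contributes \<open>u t\<close> from
        \<open>X Plus \<gamma> (- v)\<close>, \<open>u t\<close> from
        \<open>X Minus \<gamma> v\<close> and two more from the division, against the single
        coordinate \<open>c \<gamma> (v + v)\<close>; so powers of \<open>u t\<close>
        remain.\<close>
      have "(\<Sum>C\<in>G_quot N \<gamma>. F (SOME x. x \<in> C)) =
          (K (of_real (sqrt (real N))) * K (inverse (bracket1 N \<gamma> (- v)) * bracket1 N \<gamma> (v + v)) *
          (c \<gamma> (v + v) * u t)) * (t * u t) * u t * u t * u t"
      proof
        fix X
        let ?Z = "\<rho> X"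
        have "(\<Sum>C\<in>G_quot N \<gamma>. F (SOME x. x \<in> C)) X =
            sum_G N \<gamma> (\<lambda>x. bracket2 N \<gamma> x v * (?Z Plus \<gamma> x / ?Z Minus \<gamma> (x - (v + v)))) * inverse (t X) ^ 2"
          by (simp add: sum_G_def F_def sum_distrib_right)
        also have "\<dots> = of_real (sqrt (real N)) * (?Z Plus \<gamma> (- v) / (?Z Minus \<gamma> v * ?Z Minus \<gamma> (- (v + v)))) *
            inverse (t X) ^ 2"
          by (simp only: point_quadratic_sum[OF \<rho> \<gamma> v N])
        also have "?Z Plus \<gamma> (- v) / (?Z Minus \<gamma> v * ?Z Minus \<gamma> (- (v + v))) =
            ?Z Plus \<gamma> (- v) / ?Z Minus \<gamma> v * (1 / ?Z Minus \<gamma> (- (v + v)))" by simp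
        also have "1 / ?Z Minus \<gamma> (- (v + v)) = bracket1 N \<gamma> (v + v) * ?Z Plus \<gamma> (v + v)"
          by (subst point_inverse_Minus[OF \<rho> \<gamma>]) simp
        also have "?Z Plus \<gamma> (- v) = inverse (bracket1 N \<gamma> (- v)) * inverse (t X)"
          using point_inverse[OF \<rho> \<gamma>, of X "- v"] point_Minus[OF \<rho> \<gamma> v, of X] C_nz[OF t(1), of X]
            bracket1_nonzero[of N \<gamma> "- v"]
          by (simp add: t_eq c_def field_simps)
        also have "?Z Minus \<gamma> v = t X" using point_Minus[OF \<rho> \<gamma> v] by (simp add: t_eq c_def)
        finally show "(\<Sum>C\<in>G_quot N \<gamma>. F (SOME x. x \<in> C)) X = ((K (of_real (sqrt (real N))) *
          K (inverse (bracket1 N \<gamma> (- v)) * bracket1 N \<gamma> (v + v)) *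
          (c \<gamma> (v + v) * u t)) * (t * u t) * u t * u t * u t) X"
          using C_nz[OF t(1), of X] by (simp add: K_def u_def c_def power2_eq_square divide_inverse)
      qed
      moreover have root: "K (inverse (bracket1 N \<gamma> (- v)) * bracket1 N \<gamma> (v + v)) \<in> A"
        by (rule root_mem) (simp add: power_mult_distrib power_inverse bracket1_power[OF N])
      moreover have "u t \<in> A" "t * u t \<in> A" using t_inv ideal_subset tt one_mem by auto
      ultimately show "(\<Sum>C\<in>G_quot N \<gamma>. F (SOME x. x \<in> C)) \<in> I"
        by (simp only: sqrt_mem root ratio mult_mem mult_mem_ideal t_inv)
    qed
    \<comment> \<open>At \<open>x = v\<close> both ratios are 1, leaving a root of unity; its
      inverse lies in \<open>A\<close>, which forces \<open>1 \<in> I\<close>.\<close>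
    moreover have "F v = K (bracket2 N \<gamma> v v * bracket1 N \<gamma> v)"
      unfolding F_eq by (simp add: tt flip: t_eq)
    moreover have "K (inverse (bracket2 N \<gamma> v v * bracket1 N \<gamma> v)) \<in> A"
      by (rule root_mem)
        (simp add: power_mult_distrib power_inverse bracket1_power[OF N] bracket2_power[OF N])
    moreover have "K (inverse (bracket2 N \<gamma> v v * bracket1 N \<gamma> v)) * K (bracket2 N \<gamma> v v * bracket1 N \<gamma> v) = 1"
      unfolding K_def fun_eq_iff times_fun_apply one_fun_apply
      by (intro allI left_inverse) (simp add: bracket1_nonzero bracket2_def)
    ultimately show False using mult_mem_ideal AI(4) by metis
  qed
qed

section \<open>Valuations and finiteness\<close>

interpretation complex_rat: vector_space "\<lambda>(q::rat) (z::complex). of_rat q * z"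
  by standard (simp_all add: of_rat_add of_rat_mult algebra_simps)

text \<open>The powers of \<open>poly g y\<close> all lie in the rational span of the first
  \<open>d\<close> powers of \<open>y\<close>, so \<open>d + 1\<close> of them are linearly
  dependent.\<close>

lemma algebraic_poly:
  fixes y :: complex
  assumes "algebraic y" and g: "\<And>i. coeff g i \<in> \<rat>"
  shows "algebraic (poly g y)"
proof -
  obtain p where p: "\<And>i. coeff p i \<in> \<rat>" "p \<noteq> 0" "poly p y = 0"
    using assms(1) unfolding algebraic_altdef by blast
  define d where "d = degree p"
  define T where "T = (\<lambda>i. y ^ i) ` {..<d}"
  have scale: "c * x \<in> complex_rat.span T" if "c \<in> \<rat>" "x \<in> complex_rat.span T" for c x
    using that by (auto elim!: Rats_cases intro: complex_rat.span_scale)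
  have powers: "y ^ n \<in> complex_rat.span T" for n
  proof (induction n rule: less_induct)
    case (less n)
    show ?case
    proof (cases "n < d")
      case True
      then show ?thesis by (intro complex_rat.span_base) (auto simp: T_def)
    next
      case False
      have lead: "coeff p d \<noteq> 0" using p(2) by (simp add: d_def)
      have "(\<Sum>i<d. coeff p i * y ^ i) + coeff p d * y ^ d = 0"
        using p(3) by (simp add: poly_altdef d_def flip: lessThan_Suc_atMost)
      then have "y ^ d = - (\<Sum>i<d. coeff p i * y ^ i) / coeff p d"
        using lead by (simp add: field_simps eq_neg_iff_add_eq_0)
      moreover have "y ^ n = y ^ d * y ^ (n - d)" using False by (simp flip: power_add)
      ultimately have "y ^ n = (\<Sum>i<d. (- coeff p i / coeff p d) * y ^ (i + (n - d)))"
        by (simp add: sum_distrib_left sum_distrib_right sum_negf sum_divide_distrib power_add mult_ac)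
      also have "\<dots> \<in> complex_rat.span T"
        using False less p(1) by (intro complex_rat.span_sum scale) auto
      finally show ?thesis .
    qed
  qed
  have poly_span: "poly h y \<in> complex_rat.span T" if "\<And>i. coeff h i \<in> \<rat>" for h
    unfolding poly_altdef using that powers by (intro complex_rat.span_sum scale) auto
  define z where "z = poly g y"
  have "coeff (g ^ n) i \<in> \<rat>" for n i
  proof (induction n arbitrary: i)
    case (Suc n)
    then show ?case using g by (auto simp: coeff_mult intro!: Rats_sum Rats_mult)
  qed (simp add: coeff_pCons split: nat.splits)
  then have z: "z ^ n \<in> complex_rat.span T" for n
    using poly_span[of "g ^ n"] by (simp add: z_def)
  have "algebraic z"
  \<comment> \<open>Dependence is a property of the set of powers; if two of them coincide, they
    give a polynomial relation directly.\<close>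
  proof (cases "inj_on (\<lambda>n. z ^ n) {..d}")
    case True
    define S where "S = (\<lambda>n. z ^ n) ` {..d}"
    have "finite S" "card S = Suc d" using True by (simp_all add: S_def card_image)
    moreover have "finite T" "card T \<le> d" using card_image_le[of "{..<d}"] by (simp_all add: T_def)
    moreover have "S \<subseteq> complex_rat.span T" using z by (auto simp: S_def)
    ultimately have "complex_rat.dependent S"
      using complex_rat.independent_span_bound[of T S] by auto
    then obtain w where w: "\<exists>x\<in>S. w x \<noteq> 0" "(\<Sum>x\<in>S. of_rat (w x) * x) = 0"
      using complex_rat.dependent_finite[OF \<open>finite S\<close>] by auto
    define q where "q = (\<Sum>n\<le>d. monom (of_rat (w (z ^ n)) :: complex) n)"
    have coeff_q: "coeff q n = (if n \<le> d then of_rat (w (z ^ n)) else 0)" for n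
      by (simp add: q_def coeff_sum)
    show ?thesis
    proof (rule algebraicI'[of q])
      show "coeff q i \<in> \<rat>" for i by (simp add: coeff_q)
      have "poly q z = (\<Sum>x\<in>S. of_rat (w x) * x)"
        using True by (simp add: q_def poly_sum poly_monom S_def sum.reindex)
      then show "poly q z = 0" using w(2) by simp
      obtain n where "n \<le> d" "w (z ^ n) \<noteq> 0" using w(1) by (auto simp: S_def)
      then have "coeff q n \<noteq> 0" by (simp add: coeff_q)
      then show "q \<noteq> 0" by auto
    qed
  next
    case False
    then obtain a b where ab: "a \<noteq> b" "z ^ a = z ^ b" by (auto simp: inj_on_def)
    show ?thesis
    proof (rule algebraicI'[of "monom 1 a - monom 1 b"])
      have "coeff (monom (1::complex) a - monom 1 b) a = 1" using ab by simp
      then show "monom (1::complex) a - monom 1 b \<noteq> 0" by (metis coeff_0 zero_neq_one)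
    qed (use ab in \<open>auto simp: poly_monom\<close>)
  qed
  then show ?thesis by (simp add: z_def)
qed

lemma Qbar_iff: "z \<in> Qbar \<longleftrightarrow> algebraic z"
  by (simp add: Qbar_def)

lemma Qbar_int_sum:
  assumes "y \<in> Qbar"
  shows "(\<Sum>i<m. of_int (b i) * y ^ i) \<in> Qbar"
proof -
  have "algebraic (poly (\<Sum>i<m. monom (of_int (b i)) i) y)"
    using assms by (intro algebraic_poly) (auto simp: Qbar_iff coeff_sum)
  then show ?thesis by (simp add: Qbar_iff poly_sum poly_monom)
qed

lemma Qbar_power: "y \<in> Qbar \<Longrightarrow> y ^ n \<in> Qbar"
  using algebraic_poly[of y "monom 1 n"] by (simp add: Qbar_iff poly_monom)

section \<open>Valuations extending the 2-adic one\<close>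

context
  fixes v :: "complex \<Rightarrow> real"
  assumes v: "extends_2adic v"
begin

lemma extends_2adic_mult: "x \<in> Qbar \<Longrightarrow> x \<noteq> 0 \<Longrightarrow> y \<in> Qbar \<Longrightarrow> y \<noteq> 0 \<Longrightarrow> v (x * y) = v x + v y"
  using v by (simp add: extends_2adic_def)

lemma extends_2adic_add:
  "x \<in> Qbar \<Longrightarrow> x \<noteq> 0 \<Longrightarrow> y \<in> Qbar \<Longrightarrow> y \<noteq> 0 \<Longrightarrow> x + y \<noteq> 0 \<Longrightarrow> v (x + y) \<ge> min (v x) (v y)"
  using v by (simp add: extends_2adic_def)

lemma extends_2adic_of_int: "a \<noteq> 0 \<Longrightarrow> v (of_int a) = real (multiplicity 2 a)"
proof -
  assume "a \<noteq> 0"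
  then have "v (of_int a / of_int 1) = real (multiplicity 2 a) - real (multiplicity 2 (1::int))"
    using v unfolding extends_2adic_def by (metis zero_neq_one)
  then show ?thesis by simp
qed

lemma extends_2adic_power:
  assumes "x \<in> Qbar" "x \<noteq> 0"
  shows "v (x ^ n) = real n * v x"
proof (induction n)
  case 0
  then show ?case using extends_2adic_of_int[of 1] by simp
next
  case (Suc n)
  then show ?case
    using extends_2adic_mult[OF assms Qbar_power[OF assms(1), of n]] assms(2)
    by (simp add: algebra_simps)
qed

lemma extends_2adic_root_of_unity:
  assumes "z ^ n = 1" "n > 0"
  shows "z \<in> Qbar" "v z = 0"
proof -
  have "coeff (monom (1::complex) n - 1) n = 1" using assms(2) by simp
  then have "monom (1::complex) n - 1 \<noteq> 0" by (metis coeff_0 zero_neq_one)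
  then show "z \<in> Qbar" unfolding Qbar_iff
    by (rule algebraicI'[rotated]) (use assms in \<open>auto simp: poly_monom coeff_1\<close>)
  moreover have "z \<noteq> 0" using assms by (auto simp: power_0_left)
  ultimately have "real n * v z = v 1" using extends_2adic_power[of z n] assms by simp
  then show "v z = 0" using extends_2adic_of_int[of 1] assms(2) by simp
qed

text \<open>The alternative of a zero sum is present because \<open>extends_2adic\<close> says
  nothing about \<open>v 0\<close>.\<close>

lemma extends_2adic_int_sum:
  assumes y: "y \<in> Qbar" "y \<noteq> 0" "v y \<ge> 0"
  shows "(\<Sum>i<m. of_int (b i) * y ^ i) = 0 \<or> v (\<Sum>i<m. of_int (b i) * y ^ i) \<ge> 0"
proof (induction m)
  case (Suc m)
  let ?z = "\<Sum>i<m. of_int (b i) * y ^ i" and ?x = "of_int (b m) * y ^ m"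
  have x: "v ?x \<ge> 0" "?x \<in> Qbar" if "b m \<noteq> 0"
  proof -
    have "v ?x = v (of_int (b m)) + v (y ^ m)"
      using that y by (intro extends_2adic_mult Qbar_power) (auto simp: Qbar_iff)
    then show "v ?x \<ge> 0"
      using that y by (simp add: extends_2adic_of_int extends_2adic_power)
    show "?x \<in> Qbar"
      using algebraic_poly[of y "monom (of_int (b m)) m"] y by (simp add: Qbar_iff poly_monom)
  qed
  show ?case
  proof (cases "?z = 0 \<or> ?x = 0 \<or> ?z + ?x = 0")
    case True
    then show ?thesis using Suc x y by (cases "b m = 0") auto
  next
    case False
    then have "b m \<noteq> 0" by auto
    then have "v (?z + ?x) \<ge> min (v ?z) (v ?x)"
      using False x Qbar_int_sum[OF y(1)] by (intro extends_2adic_add) auto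
    then show ?thesis using Suc x[OF \<open>b m \<noteq> 0\<close>] False by simp
  qed
qed simp

text \<open>If \<open>v x < 0\<close>, then \<open>inverse x\<close> has positive valuation, and so
  has the odd integer \<open>1 - a 0\<close>, being \<open>inverse x\<close> times an integer
  polynomial in \<open>inverse x\<close>. But odd integers have valuation 0.\<close>

lemma extends_2adic_integral:
  assumes x: "x \<in> Qbar" "x \<noteq> 0"
    and a: "even (a 0 :: int)" "(\<Sum>i\<le>n. of_int (a i) * inverse x ^ i) = 1"
  shows "v x \<ge> 0"
proof (rule ccontr)
  assume neg: "\<not> v x \<ge> 0"
  define y where "y = inverse x"
  have y: "y \<in> Qbar" "y \<noteq> 0" using x by (auto simp: y_def Qbar_iff)
  have "v x + v y = v 1" using extends_2adic_mult[OF x y] x by (simp add: y_def)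
  then have vy: "v y > 0" using neg extends_2adic_of_int[of 1] by simp
  define S where "S = (\<Sum>i<n. of_int (a (Suc i)) * y ^ i)"
  have "1 = of_int (a 0) + y * S"
    using a(2) unfolding y_def[symmetric]
    by (simp add: sum.atMost_shift S_def sum_distrib_left mult_ac)
  then have eq: "of_int (1 - a 0) = y * S" by (simp add: algebra_simps)
  have odd: "1 - a 0 \<noteq> 0" "multiplicity 2 (1 - a 0) = 0"
    using a(1) by (auto simp: not_dvd_imp_multiplicity_0)
  then have S: "S \<noteq> 0" using eq by (metis mult_zero_right of_int_eq_0_iff)
  then have "v S \<ge> 0" using extends_2adic_int_sum[OF y, where m = n and b = "\<lambda>i. a (Suc i)"] vy
    by (auto simp: S_def)
  moreover have "v (y * S) = v y + v S"
    using y S Qbar_int_sum[OF y(1), where m = n and b = "\<lambda>i. a (Suc i)"]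
    by (intro extends_2adic_mult) (simp_all add: S_def)
  ultimately show False
    using eq extends_2adic_of_int[OF odd(1)] odd(2) vy by simp
qed

end

section \<open>Finiteness of the set of points and the unit property\<close>

lemma XN_points_mono: "XN_points N K \<subseteq> XN_points N UNIV"
proof -
  have "coordinate_family N UNIV X" if "coordinate_family N K X" for X
    using that unfolding coordinate_family_def
    by - (elim conjE, intro conjI, assumption, (intro allI ballI UNIV_I), assumption+)
  then show ?thesis unfolding XN_points_def by blast
qed

text \<open>The two signs agree outside the lattice. The remaining coordinate, \<open>Minus\<close>
  at 0, has the explicit equation of \<open>coordinate_zero\<close> divided by its fourth
  power.\<close>

lemma coordinate_integrality_pm:
  assumes N: "N \<ge> 1" and \<gamma>: "\<gamma> \<in> GammaN N"
  shows "\<exists>n a. even (a 0 :: int) \<and>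
    (\<forall>X\<in>XN_points N UNIV. (\<Sum>i\<le>n. of_int (a i) * inverse (X s \<gamma> u) ^ i) = 1)"
proof (cases "s = Minus \<and> u \<in> Lam N \<gamma>")
  case False
  have eq: "X s \<gamma> u = X Plus \<gamma> u" if "X \<in> XN_points N UNIV" for X
    using False point_Minus[OF that \<gamma>, of u] by (cases s) auto
  obtain n a where a: "even (a 0 :: int)"
    "\<forall>X\<in>XN_points N UNIV. (\<Sum>i\<le>n. of_int (a i) * inverse (X Plus \<gamma> u) ^ i) = 1"
    using coordinate_integrality[OF N \<gamma>, of u] by blast
  have "(\<Sum>i\<le>n. of_int (a i) * inverse (X s \<gamma> u) ^ i) = 1" if "X \<in> XN_points N UNIV" for X
    unfolding eq[OF that] using a(2) that by blast
  then show ?thesis using a(1) by blast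
next
  case True
  define a :: "nat \<Rightarrow> int" where "a = (\<lambda>i. if i = 2 then int (N + 2) else if i = 4 then - 1 else 0)"
  have "(\<Sum>i\<le>4. of_int (a i) * inverse (X s \<gamma> u) ^ i) = 1" if X: "X \<in> XN_points N UNIV" for X
  proof -
    define z where "z = X s \<gamma> 0"
    have "X s \<gamma> u = z" unfolding z_def using True by (intro point_periodic[OF X \<gamma>]) simp
    moreover have "z \<noteq> 0" unfolding z_def by (rule point_nonzero[OF X \<gamma>])
    moreover have "z ^ 4 + 1 = of_nat (N + 2) * z ^ 2"
      unfolding z_def by (rule coordinate_zero[OF point_local[OF X \<gamma>]])
    then have "of_nat (N + 2) * z ^ 2 - 1 = z ^ 4" by (simp add: algebra_simps)
    then have "(of_nat (N + 2) * z ^ 2 - 1) / z ^ 4 = 1" using \<open>z \<noteq> 0\<close> by simp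
    moreover have "(of_nat (N + 2) * z ^ 2 - 1) / z ^ 4 = of_nat (N + 2) * inverse z ^ 2 - inverse z ^ 4"
      using \<open>z \<noteq> 0\<close> by (simp add: field_simps power2_eq_square power4_eq_xxxx)
    moreover have "{..4::nat} = {0, 1, 2, 3, 4}" by auto
    ultimately show ?thesis by (simp add: a_def)
  qed
  then show ?thesis by (intro exI[of _ 4] exI[of _ a]) (simp add: a_def)
qed

text \<open>The inverses of the values are roots of one polynomial, which is nonzero since its
  constant term \<open>a 0 - 1\<close> is odd.\<close>

lemma finite_coordinate_values:
  assumes N: "N \<ge> 1" and \<gamma>: "\<gamma> \<in> GammaN N"
  shows "finite ((\<lambda>X. X s \<gamma> u) ` XN_points N UNIV)"
proof -
  obtain n a where a: "even (a 0 :: int)"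
    "\<And>X. X \<in> XN_points N UNIV \<Longrightarrow> (\<Sum>i\<le>n. of_int (a i) * inverse (X s \<gamma> u) ^ i) = 1"
    using coordinate_integrality_pm[OF N \<gamma>] by blast
  define q where "q = (\<Sum>i\<le>n. monom (of_int (a i) :: complex) i) - 1"
  have "coeff q 0 = of_int (a 0 - 1)" by (simp add: q_def coeff_sum)
  moreover have "a 0 - 1 \<noteq> 0" using a(1) by auto
  ultimately have "coeff q 0 \<noteq> 0" by (metis of_int_eq_0_iff)
  then have "q \<noteq> 0" by auto
  have "(\<lambda>X. X s \<gamma> u) ` XN_points N UNIV \<subseteq> inverse ` {z. poly q z = 0}"
  proof
    fix z assume "z \<in> (\<lambda>X. X s \<gamma> u) ` XN_points N UNIV"
    then have "poly q (inverse z) = 0" using a(2) by (auto simp: q_def poly_sum poly_monom)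
    then show "z \<in> inverse ` {z. poly q z = 0}" by (intro image_eqI[of _ _ "inverse z"]) auto
  qed
  then show ?thesis by (rule finite_subset) (intro finite_imageI poly_roots_finite \<open>q \<noteq> 0\<close>)
qed

text \<open>A point is determined by its values at the reduced indices, each of which takes finitely
  many values. At matrices outside \<open>GammaN N\<close> all families vanish by
  convention.\<close>

lemma finite_XN_points:
  assumes N: "N \<ge> 1"
  shows "finite (XN_points N UNIV)"
proof -
  define J where "J = (UNIV :: sgn_pm set) \<times> reduced_indices N"
  define val where "val X = restrict (\<lambda>(s, \<gamma>, u). X s \<gamma> u) J" for X :: coords
  have "UNIV = {Plus, Minus}" using sgn_pm.exhaust by auto
  then have "finite (UNIV :: sgn_pm set)" by (metis finite.emptyI finite.insertI)
  then have "finite J" unfolding J_def using finite_reduced_indices by (rule finite_cartesian_product)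
  have "val ` XN_points N UNIV \<subseteq> (\<Pi>\<^sub>E (s, \<gamma>, u)\<in>J. (\<lambda>X. X s \<gamma> u) ` XN_points N UNIV)"
    by (auto simp: val_def)
  moreover have "finite (\<Pi>\<^sub>E (s, \<gamma>, u)\<in>J. (\<lambda>X. X s \<gamma> u) ` XN_points N UNIV)"
    using \<open>finite J\<close> finite_coordinate_values[OF N]
    by (intro finite_PiE) (auto simp: J_def reduced_indices_def)
  ultimately have "finite (val ` XN_points N UNIV)" by (rule finite_subset)
  moreover have "inj_on val (XN_points N UNIV)"
  proof (rule inj_onI)
    fix X X' assume X: "X \<in> XN_points N UNIV" "X' \<in> XN_points N UNIV" and eq: "val X = val X'"
    have "X s \<gamma> u = X' s \<gamma> u" for s \<gamma> u
    proof (cases "\<gamma> \<in> GammaN N")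
      case True
      obtain \<beta> v where v: "(\<beta>, v) \<in> reduced_indices N"
        "\<And>X s. X \<in> XN_points N UNIV \<Longrightarrow> X s \<gamma> u = X s \<beta> v"
        using reduced_index_exists[OF N True] by blast
      have "X s \<beta> v = X' s \<beta> v"
        using fun_cong[OF eq, of "(s, \<beta>, v)"] v(1) by (simp add: val_def J_def)
      then show ?thesis using v(2)[OF X(1)] v(2)[OF X(2)] by metis
    next
      case False
      have "\<forall>s. \<forall>\<gamma>. \<gamma> \<notin> GammaN N \<longrightarrow> (\<forall>u. Z s \<gamma> u = 0)" if "Z \<in> XN_points N UNIV" for Z
        using point_family[OF that] unfolding coordinate_family_def by (elim conjE)
      then show ?thesis using X False by metis
    qed
    then show "X = X'" by (simp add: fun_eq_iff)
  qed
  ultimately show ?thesis by (rule finite_imageD)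
qed

theorem theorem11:
  fixes N :: nat
  assumes "N \<ge> 1"
  shows "(\<forall>X \<in> XN_points N Qbar. \<forall>s. \<forall>\<gamma> \<in> GammaN N. \<forall>u. two_adic_unit (X s \<gamma> u)) \<and>
         finite (XN_points N UNIV)"
proof (intro conjI ballI allI)
  fix X s \<gamma> u assume XQ: "X \<in> XN_points N Qbar" and \<gamma>: "\<gamma> \<in> GammaN N"
  then have X: "X \<in> XN_points N UNIV" using XN_points_mono by blast
  have "coordinate_family N Qbar X" using XQ unfolding XN_points_def by blast
  then have "\<forall>s. \<forall>\<gamma>\<in>GammaN N. \<forall>u. X s \<gamma> u \<in> Qbar"
    unfolding coordinate_family_def by (elim conjE)
  then have Q: "X s \<gamma> u \<in> Qbar" for s u using \<gamma> by blast
  have nz: "X s \<gamma> u \<noteq> 0" for s u using point_nonzero[OF X \<gamma>] .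
  have "v (X s \<gamma> u) = 0" if v: "extends_2adic v" for v
  proof -
    have nonneg: "v (X s \<gamma> u) \<ge> 0" for s u
    proof -
      obtain n a where "even (a 0 :: int)" "(\<Sum>i\<le>n. of_int (a i) * inverse (X s \<gamma> u) ^ i) = 1"
        using coordinate_integrality_pm[OF assms \<gamma>, of s u] X by blast
      then show ?thesis by (rule extends_2adic_integral[OF v Q nz])
    qed
    have "v (X Plus \<gamma> u) + v (X Minus \<gamma> (- u)) = 0" for u
    proof -
      have "v (inverse (bracket1 N \<gamma> u)) = 0"
        using assms by (intro extends_2adic_root_of_unity(2)[OF v, of _ "2 * N"])
          (simp_all add: power_inverse bracket1_power)
      then show ?thesis
        using extends_2adic_mult[OF v Q nz Q nz] point_inverse[OF X \<gamma>] by metis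
    qed
    \<comment> \<open>Two nonnegative numbers with sum 0 vanish; the claim for \<open>Minus\<close>
      at \<open>u\<close> uses the relation at \<open>- u\<close>.\<close>
    then have "v (X Plus \<gamma> u) = 0" "v (X Minus \<gamma> u) = 0" for u
      using nonneg[of Plus u] nonneg[of Minus "- u"] nonneg[of Plus "- u"] nonneg[of Minus u]
      by (smt (verit) minus_minus)+
    then show ?thesis by (cases s) auto
  qed
  then show "two_adic_unit (X s \<gamma> u)" using Q nz by (simp add: two_adic_unit_def)
qed (rule finite_XN_points[OF assms])

end
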